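(* Let $n\ge 2$ and $\ell,k\in[n-1]$. We have the identity $g\circ R=g$ of rational maps $\mathbb X_\ell\times\mathbb X_k\to B^-$. That is, if $(u,v)\in\mathbb X_\ell\times\mathbb X_k$, $R(u,v)=(v',u')$, and $g(v'),g(u')$ are defined, then $$g(u)g(v)=g(v')g(u').$$
   Context: Notation. Fix $n\ge2$; $[m]=\{1,\dots,m\}$, $[i,j]=\{m\in\mathbb Z: i\le m\le j\}$. For $k\in[n-1]$, $\mathbb X_k=\mathrm{Gr}(k,n)\times\mathbb C^\times$, with points written $N|t$. A subspace $N\in\mathrm{Gr}(k,n)$ is the column span of a full-rank $n\times k$ matrix, and $P_J(N)$ is the maximal minor of that matrix with row set $J$ (rows in increasing order), defined up to a common nonzero scalar. Index sets of integers are reduced modulo $n$ to subsets of $[n]$, and $P_I:=0$ if the reduced set does not have exactly $k$ elements. The map $g$. $\lambda$ is an indeterminate. $B^-$ is the monoid of $n\times n$ matrices over $\mathbb C[\lambda]$ with nonzero determinant whose diagonal entries have nonzero constant term and whose entries above the diagonal have zero constant term. The rational map $g:\mathbb X_k\to B^-$ is given by $g(N|t)_{ij}=c_{ij}\,P_{[j-k+1,j-1]\cup\{i\}}(N)/P_{[j-k,j-1]}(N)$, where $c_{ij}=1$ if $j\le k$; $c_{ij}=t$ if $j>k$ and $i\ge j$; $c_{ij}=\lambda$ if $j>k$ and $i<j$. It is defined iff all $P_{[j-k,j-1]}(N)$ are nonzero. On products, $g(x_1,\dots,x_d)=g(x_1)\cdots g(x_d)$. The geometric $R$-matrix. For $z\in\mathbb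 C^\times$ and an $n\times n$ matrix $A$ over $\mathbb C[\lambda,\lambda^{-1}]$, $\pi^k_z(A)=N|z$ where $N$ is the span of the first $k$ columns of $A|_{\lambda=(-1)^{k-1}z}$ (defined when these columns are linearly independent). Let $\mathrm{fl}(A)_{ij}=A_{n-j+1,n-i+1}$. Define $S:\mathbb X_k\to\mathbb X_k$ by $S(N|t)=\pi^k_t(\mathrm{fl}(g(N|t)))$, and on products $S(x_1,\dots,x_d)=(S(x_d),\dots,S(x_1))$. Define $\Psi_{k,\ell}:\mathbb X_\ell\times\mathbb X_k\to\mathbb X_k$ by $\Psi_{k,\ell}(M|s,N|t)=\pi^k_t(g(M|s)g(N|t))$. The geometric $R$-matrix is the rational map $R=(\Psi_{k,\ell},\ S\circ\Psi_{\ell,k}\circ S):\mathbb X_\ell\times\mathbb X_k\to\mathbb X_k\times\mathbb X_\ell$. *)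

theory Defs
  imports
    "HOL-Library.Monad_Syntax"
    "Jordan_Normal_Form.DL_Rank"
    "Jordan_Normal_Form.DL_Submatrix"
begin

text \<open>Matrices and vectors are those of \<open>Jordan_Normal_Form\<close>, whose entries are numbered from 0.
  The formulas below use rows, columns and index sets numbered from 1, as integers; the translation
  is confined to \<open>index_set\<close>, \<open>gmat\<close> and \<open>flip_mat\<close>.  Rational maps are partial functions into an
  \<open>option\<close> type, the value \<open>None\<close> meaning that the defining formula does not make sense.\<close>

definition indep_cols :: "nat \<Rightarrow> complex mat \<Rightarrow> bool" where
  "indep_cols n M \<longleftrightarrow> distinct (cols M) \<and>
     \<not> LinearCombinations.module.lin_dep class_ring (module_vec TYPE(complex) n) (set (cols M))"

definition represents :: "nat \<Rightarrow> nat \<Rightarrow> complex mat \<Rightarrow> complex vec set \<Rightarrow> bool" where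
  "represents n k M N \<longleftrightarrow>
     M \<in> carrier_mat n k \<and> vec_space.rank n M = k \<and> vec_space.col_space n M = N"

definition Gr :: "nat \<Rightarrow> nat \<Rightarrow> complex vec set set" where
  "Gr k n = {N. \<exists>M. represents n k M N}"

type_synonym point = "complex vec set \<times> complex"

definition X_var :: "nat \<Rightarrow> nat \<Rightarrow> point set" where
  "X_var n k = Gr k n \<times> (UNIV - {0})"

text \<open>Reduction modulo \<open>n\<close> of a set of 1-based integer indices to a set of 0-based row numbers:
  the class of \<open>i\<close> is sent to \<open>i - 1\<close> when \<open>1 \<le> i \<le> n\<close>.\<close>

definition index_set :: "nat \<Rightarrow> int set \<Rightarrow> nat set" where
  "index_set n I = (\<lambda>i. nat ((i - 1) mod int n)) ` I"

text \<open>Pluecker coordinates are only defined up to a common nonzero scalar.  Here the scalar is fixed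
  by choosing one representing matrix for each subspace; only ratios of two coordinates of the same
  subspace, and their vanishing, are used below, and these do not depend on the choice.\<close>

definition plucker :: "nat \<Rightarrow> nat \<Rightarrow> complex vec set \<Rightarrow> int set \<Rightarrow> complex" where
  "plucker n k N I =
     (let M = (SOME M. represents n k M N); J = index_set n I
      in if card J = k then det (submatrix M J UNIV) else 0)"

text \<open>Polynomials in the indeterminate \<open>\<lambda>\<close> have type \<open>complex poly\<close>; \<open>[:0, 1:]\<close> is \<open>\<lambda>\<close> itself.\<close>

definition gcoeff :: "nat \<Rightarrow> complex \<Rightarrow> int \<Rightarrow> int \<Rightarrow> complex poly" where
  "gcoeff k t i j = (if j \<le> int k then 1 else if i \<ge> j then [:t:] else [:0, 1:])"

definition gmat :: "nat \<Rightarrow> nat \<Rightarrow> point \<Rightarrow> complex poly mat" where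
  "gmat n k = (\<lambda>(N, t). mat n n (\<lambda>(i0, j0).
     let i = int i0 + 1; j = int j0 + 1 in
       gcoeff k t i j *
       [: plucker n k N ({j - int k + 1 .. j - 1} \<union> {i}) / plucker n k N {j - int k .. j - 1} :]))"

definition g_map :: "nat \<Rightarrow> nat \<Rightarrow> point \<Rightarrow> complex poly mat option" where
  "g_map n k = (\<lambda>(N, t).
     if \<forall>j \<in> {1 .. int n}. plucker n k N {j - int k .. j - 1} \<noteq> 0
     then Some (gmat n k (N, t)) else None)"

text \<open>The map \<open>\<pi>\<^sup>k\<^sub>z\<close>, where \<open>\<lambda>\<close> is specialised to \<open>(-1)\<^sup>k\<^sup>-\<^sup>1 z\<close>.  It makes sense for Laurent
  polynomial entries too, but below it is only applied to matrices with polynomial entries.\<close>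

definition pi_map :: "nat \<Rightarrow> nat \<Rightarrow> complex \<Rightarrow> complex poly mat \<Rightarrow> point option" where
  "pi_map n k z A =
     (let B = map_mat (\<lambda>p. poly p ((- 1) ^ (k - 1) * z)) A;
          M = mat_of_cols n (take k (cols B))
      in if indep_cols n M then Some (vec_space.col_space n M, z) else None)"

text \<open>Reflection in the anti-diagonal: in 1-based numbering, the \<open>(i, j)\<close> entry of \<open>flip_mat A\<close> is the \<open>(n - j + 1, n - i + 1)\<close> entry of \<open>A\<close>.\<close>

definition flip_mat :: "nat \<Rightarrow> 'a mat \<Rightarrow> 'a mat" where
  "flip_mat n A = mat n n (\<lambda>(i, j). A $$ (n - 1 - j, n - 1 - i))"

definition S_map :: "nat \<Rightarrow> nat \<Rightarrow> point \<Rightarrow> point option" where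
  "S_map n k = (\<lambda>(N, t). do {
     A \<leftarrow> g_map n k (N, t);
     pi_map n k t (flip_mat n A)
   })"

text \<open>\<open>S_pair n l k\<close> is the map \<open>S\<close> on \<open>X_var n l \<times> X_var n k\<close>, with values in \<open>X_var n k \<times> X_var n l\<close>.\<close>

definition S_pair :: "nat \<Rightarrow> nat \<Rightarrow> nat \<Rightarrow> point \<times> point \<Rightarrow> (point \<times> point) option" where
  "S_pair n l k = (\<lambda>(u, v). do {
     v' \<leftarrow> S_map n k v;
     u' \<leftarrow> S_map n l u;
     Some (v', u')
   })"

text \<open>\<open>Psi n k l\<close> is \<open>\<Psi>\<^bsub>k,l\<^esub>\<close>, a partial map from \<open>X_var n l \<times> X_var n k\<close> to \<open>X_var n k\<close>.\<close>

definition Psi :: "nat \<Rightarrow> nat \<Rightarrow> nat \<Rightarrow> point \<times> point \<Rightarrow> point option" where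
  "Psi n k l = (\<lambda>(u, (N, t)). do {
     A \<leftarrow> g_map n l u;
     B \<leftarrow> g_map n k (N, t);
     pi_map n k t (A * B)
   })"

text \<open>The geometric \<open>R\<close>-matrix from \<open>X_var n l \<times> X_var n k\<close> to \<open>X_var n k \<times> X_var n l\<close>.\<close>

definition geom_R :: "nat \<Rightarrow> nat \<Rightarrow> nat \<Rightarrow> point \<times> point \<Rightarrow> (point \<times> point) option" where
  "geom_R n l k = (\<lambda>p. do {
     v' \<leftarrow> Psi n k l p;
     q \<leftarrow> S_pair n l k p;
     w \<leftarrow> Psi n l k q;
     u' \<leftarrow> S_map n l w;
     Some (v', u')
   })"

end

theory Submission
  imports Defs
begin

text \<open>
  \<^bold>\<open>Band matrices.\<close> Number the basis vectors \<open>\<lambda>\<^sup>m e\<^sub>i\<close> of \<open>\<complex>[\<lambda>]\<^sup>n\<close> by \<open>m n + i\<close>. A polynomial matrix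
  then acts as an infinite matrix, and \<open>g(N|t)\<close> becomes a lower triangular band matrix: its main
  diagonal has no zero entry, and its last nonzero diagonal, at distance \<open>n - k\<close> from the main one,
  consists of ones. So it behaves like a monic difference operator of order \<open>n - k\<close>, and one can
  divide by it with remainder (\<open>monic_band_division\<close>).

  \<^bold>\<open>Divisibility.\<close> At \<open>\<lambda> = (-1)\<^sup>k\<^sup>-\<^sup>1 t\<close> the columns of \<open>g(N|t)\<close> lie in \<open>N\<close>. Indeed, for a fixed set \<open>J\<close> of
  \<open>k - 1\<close> rows, Laplace expansion along the row \<open>i\<close> shows that the coordinates \<open>P\<^bsub>J\<union>{i}\<^esub>(N)\<close>, with the
  sign of the position of \<open>i\<close> in \<open>J \<union> {i}\<close>, form a vector of \<open>N\<close>; this position only changes when \<open>i\<close>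
  jumps from the last place to the first one, and the sign in the value of \<open>\<lambda>\<close> makes up for this.
  The remainder of a division by \<open>g(N|t)\<close> is a constant vector supported on the first \<open>n - k\<close> rows. If
  the dividend takes its value at \<open>(-1)\<^sup>k\<^sup>-\<^sup>1 t\<close> in \<open>N\<close>, then so does the remainder, and it vanishes because
  \<open>P\<^bsub>[n-k+1,n]\<^esub>(N) \<noteq> 0\<close>. Hence a polynomial matrix whose columns at \<open>(-1)\<^sup>k\<^sup>-\<^sup>1 t\<close> lie in \<open>N\<close> is left
  divisible by \<open>g(N|t)\<close> (\<open>adapted_division\<close>), and \<open>g(N|t)\<close> is the only monic band matrix of its order
  with such columns (\<open>adapted_unique\<close>). In particular \<open>g \<circ> S = fl \<circ> g\<close> (\<open>adapted_flip_mat\<close>).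

  \<^bold>\<open>The identity.\<close> Let \<open>D = g(u) g(v) - g(v') g(u')\<close>. The last diagonals of both products consist of
  ones and cancel. By the choice of \<open>v'\<close>, the matrix \<open>D\<close> is left divisible by \<open>g(v')\<close>. By the choice of
  \<open>u'\<close> and the compatibility of \<open>g\<close> with \<open>S\<close>, the quotient is right divisible by \<open>g(u')\<close>; for this
  second step \<open>g(v')\<close> must be invertible at \<open>\<lambda> = (-1)\<^sup>l\<^sup>-\<^sup>1 s\<close>, which holds unless this value equals
  \<open>(-1)\<^sup>k\<^sup>-\<^sup>1 t\<close>. So \<open>D = g(v') E g(u')\<close>, and since the first and the last diagonals of the outer factors
  have no zero entries, a nonzero \<open>E\<close> would give \<open>D\<close> too many diagonals. If the two values coincide,
  comparing ranks yields \<open>k = l\<close>, and then \<open>g(v') = g(u)\<close> and \<open>g(u') = g(v)\<close>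
  (\<open>refactorization_unique\<close>).
\<close>

section \<open>Polynomial matrices as infinite band matrices\<close>

text \<open>The matrix of the action of \<open>F\<close> on polynomial vectors, in the basis whose member number
  \<open>m * n + i\<close> is \<open>\<lambda>\<^sup>m e\<^sub>i\<close>. It is periodic: adding \<open>n\<close> to both indices changes nothing.\<close>

definition unfold_mat :: "nat \<Rightarrow> 'a::comm_ring_1 poly mat \<Rightarrow> nat \<Rightarrow> nat \<Rightarrow> 'a" where
  "unfold_mat n F w z =
     (if z div n \<le> w div n then coeff (F $$ (w mod n, z mod n)) (w div n - z div n) else 0)"

lemma unfold_mat_base:
  assumes "i < n" "j < n"
  shows "unfold_mat n F (m * n + i) j = coeff (F $$ (i, j)) m"
  using assms by (simp add: unfold_mat_def)

text \<open>Unfolding is multiplicative. The sum may stop at the end of the block of \<open>n\<close> indices that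
  contains \<open>w\<close>, as multiplication by a polynomial never lowers a power of \<open>\<lambda>\<close>.\<close>

lemma unfold_mat_mult:
  fixes F G :: "'a::comm_ring_1 poly mat"
  assumes n: "n > 0" and F: "F \<in> carrier_mat n n" and G: "G \<in> carrier_mat n n"
  shows "unfold_mat n (F * G) w z =
    (\<Sum>y < (w div n + 1) * n. unfold_mat n F w y * unfold_mat n G y z)"
proof -
  define B i c j where "B = w div n" and "i = w mod n" and "c = z div n" and "j = z mod n"
  have ij: "i < n" "j < n" using n by (auto simp: i_def j_def)
  have "(\<Sum>y < (w div n + 1) * n. unfold_mat n F w y * unfold_mat n G y z)
      = (\<Sum>b < B + 1. \<Sum>y = b * n ..< b * n + n. unfold_mat n F w y * unfold_mat n G y z)"
    unfolding sum.nat_group B_def ..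
  also have "\<dots> = (\<Sum>b < B + 1. \<Sum>p < n. unfold_mat n F w (b * n + p) * unfold_mat n G (b * n + p) z)"
  proof (intro sum.cong[OF refl])
    fix b
    show "(\<Sum>y = b * n ..< b * n + n. unfold_mat n F w y * unfold_mat n G y z)
      = (\<Sum>p < n. unfold_mat n F w (b * n + p) * unfold_mat n G (b * n + p) z)"
      by (rule sum.reindex_bij_witness[of _ "\<lambda>p. b * n + p" "\<lambda>y. y - b * n"]) auto
  qed
  also have "\<dots> = (\<Sum>b \<le> B. \<Sum>p < n. coeff (F $$ (i, p)) (B - b) *
      (if c \<le> b then coeff (G $$ (p, j)) (b - c) else 0))"
    by (intro sum.cong) (auto simp: unfold_mat_def B_def c_def i_def j_def)
  also have "\<dots> = (\<Sum>b \<in> {c..B}. \<Sum>p < n. coeff (F $$ (i, p)) (B - b) * coeff (G $$ (p, j)) (b - c))"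
    by (rule sum.mono_neutral_cong_right) auto
  also have "\<dots> = unfold_mat n (F * G) w z"
  proof (cases "c \<le> B")
    case True
    have "unfold_mat n (F * G) w z = coeff (\<Sum>p<n. F $$ (i, p) * G $$ (p, j)) (B - c)"
      using True ij F G unfolding unfold_mat_def B_def c_def i_def j_def
      by (auto simp: scalar_prod_def atLeast0LessThan)
    also have "\<dots> = (\<Sum>p<n. \<Sum>a\<le>B - c. coeff (G $$ (p, j)) a * coeff (F $$ (i, p)) (B - c - a))"
      by (simp add: coeff_sum coeff_mult mult.commute[of "F $$ _"])
    also have "\<dots> = (\<Sum>a\<le>B - c. \<Sum>p<n. coeff (G $$ (p, j)) a * coeff (F $$ (i, p)) (B - c - a))"
      by (rule sum.swap)
    also have "\<dots> = (\<Sum>b \<in> {c..B}. \<Sum>p < n. coeff (F $$ (i, p)) (B - b) * coeff (G $$ (p, j)) (b - c))"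
    proof (rule sum.reindex_bij_witness[of _ "\<lambda>b. b - c" "\<lambda>a. c + a"])
      fix a assume "a \<in> {..B - c}"
      show "(\<Sum>p<n. coeff (F $$ (i, p)) (B - (c + a)) * coeff (G $$ (p, j)) (c + a - c))
        = (\<Sum>p<n. coeff (G $$ (p, j)) a * coeff (F $$ (i, p)) (B - c - a))"
        by (simp add: mult.commute)
    qed (use True in auto)
    finally show ?thesis ..
  qed (simp add: unfold_mat_def B_def c_def)
  finally show ?thesis ..
qed

text \<open>Here \<open>c\<close> is a number of diagonals: the nonzero entries of the unfolded matrix lie on the \<open>c\<close>
  diagonals that start with the main one and go down. With \<open>c = 0\<close> only the zero matrix remains.\<close>

definition lower_band :: "nat \<Rightarrow> nat \<Rightarrow> 'a::comm_ring_1 poly mat \<Rightarrow> bool" where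
  "lower_band n c F \<longleftrightarrow> F \<in> carrier_mat n n \<and>
     (\<forall>i<n. \<forall>j<n. \<forall>m. coeff (F $$ (i, j)) m \<noteq> 0 \<longrightarrow> j \<le> m * n + i \<and> m * n + i < j + c)"

text \<open>The analogue of a monic difference operator of order \<open>h\<close> with nonzero constant
  coefficient.\<close>

definition monic_band :: "nat \<Rightarrow> nat \<Rightarrow> 'a::comm_ring_1 poly mat \<Rightarrow> bool" where
  "monic_band n h F \<longleftrightarrow> lower_band n (Suc h) F \<and>
     (\<forall>i<n. coeff (F $$ (i, i)) 0 \<noteq> 0) \<and>
     (\<forall>i<n. \<forall>j<n. \<forall>m. m * n + i = j + h \<longrightarrow> coeff (F $$ (i, j)) m = 1)"

text \<open>By periodicity, the conditions on the columns with number less than \<open>n\<close> imply them for all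
  columns of the unfolded matrix.\<close>

lemma lower_band_unfold:
  assumes F: "lower_band n c F" and n: "n > 0"
    and nz: "unfold_mat n F w z \<noteq> 0"
  shows "z \<le> w \<and> w < z + c"
proof -
  have le: "z div n \<le> w div n" using nz by (auto simp: unfold_mat_def split: if_splits)
  have "coeff (F $$ (w mod n, z mod n)) (w div n - z div n) \<noteq> 0"
    using nz le by (auto simp: unfold_mat_def)
  then have "z mod n \<le> (w div n - z div n) * n + w mod n"
    "(w div n - z div n) * n + w mod n < z mod n + c"
    using F n unfolding lower_band_def by auto
  moreover have "(w div n - z div n) * n + (z div n) * n = (w div n) * n"
    using le by (metis add_mult_distrib le_add_diff_inverse2)
  moreover have "(w div n) * n + w mod n = w" "(z div n) * n + z mod n = z" by auto
  ultimately show ?thesis by linarith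
qed

lemma monic_band_unfold:
  assumes F: "monic_band n h F" and n: "n > 0"
  shows "unfold_mat n F w w \<noteq> 0" and "unfold_mat n F (z + h) z = 1"
proof -
  show "unfold_mat n F w w \<noteq> 0" using F n by (auto simp: monic_band_def unfold_mat_def)
  have le: "z div n \<le> (z + h) div n" by (rule div_le_mono) simp
  have "((z + h) div n - z div n) * n + (z div n) * n = ((z + h) div n) * n"
    using le by (metis add_mult_distrib le_add_diff_inverse2)
  moreover have "((z + h) div n) * n + (z + h) mod n = z + h" "(z div n) * n + z mod n = z" by auto
  ultimately have "((z + h) div n - z div n) * n + (z + h) mod n = z mod n + h" by linarith
  then show "unfold_mat n F (z + h) z = 1"
    using F n le unfolding monic_band_def unfold_mat_def by auto
qed

text \<open>On the two extreme diagonals of a product of band matrices, each entry is a sum with a single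
  nonzero term.\<close>

lemma unfold_mat_mult_single:
  fixes F G :: "'a::comm_ring_1 poly mat"
  assumes n: "n > 0" and F: "F \<in> carrier_mat n n" and G: "G \<in> carrier_mat n n"
    and v: "v \<le> w" and zero: "\<And>y. y \<noteq> v \<Longrightarrow> unfold_mat n F w y * unfold_mat n G y z = 0"
  shows "unfold_mat n (F * G) w z = unfold_mat n F w v * unfold_mat n G v z"
proof -
  have "w < (w div n + 1) * n"
    using n by (metis Suc_eq_plus1 dividend_less_div_times mult.commute mult_Suc)
  then have "v \<in> {..<(w div n + 1) * n}" using v by auto
  then show ?thesis
    unfolding unfold_mat_mult[OF n F G]
    by (subst sum.remove[of _ v]) (auto intro!: sum.neutral zero)
qed

lemma lower_band_mult:
  fixes F G :: "'a::comm_ring_1 poly mat"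
  assumes n: "n > 0" and F: "lower_band n (Suc a) F" and G: "lower_band n (Suc b) G"
  shows "lower_band n (Suc (a + b)) (F * G)"
proof -
  have FG: "F \<in> carrier_mat n n" "G \<in> carrier_mat n n" using F G by (auto simp: lower_band_def)
  show ?thesis unfolding lower_band_def
  proof (intro conjI allI impI)
    show "F * G \<in> carrier_mat n n" using FG by auto
    fix i j m assume ij: "i < n" "j < n" and nz: "coeff ((F * G) $$ (i, j)) m \<noteq> 0"
    have "unfold_mat n (F * G) (m * n + i) j \<noteq> 0" using nz unfold_mat_base[OF ij] by metis
    then obtain y where "unfold_mat n F (m * n + i) y * unfold_mat n G y j \<noteq> 0"
      unfolding unfold_mat_mult[OF n FG] using sum.not_neutral_contains_not_neutral by blast
    then have "unfold_mat n F (m * n + i) y \<noteq> 0" "unfold_mat n G y j \<noteq> 0" by auto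
    from lower_band_unfold[OF F n this(1)] lower_band_unfold[OF G n this(2)]
    show "j \<le> m * n + i" "m * n + i < j + Suc (a + b)" by auto
  qed
qed

lemma monic_band_mult:
  fixes F G :: "'a::idom poly mat"
  assumes n: "n > 0" and F: "monic_band n a F" and G: "monic_band n b G"
  shows "monic_band n (a + b) (F * G)"
proof -
  have bF: "lower_band n (Suc a) F" and bG: "lower_band n (Suc b) G"
    using F G by (auto simp: monic_band_def)
  have FG: "F \<in> carrier_mat n n" "G \<in> carrier_mat n n"
    using bF bG by (auto simp: lower_band_def)
  note zF = lower_band_unfold[OF bF n] and zG = lower_band_unfold[OF bG n]
  show ?thesis unfolding monic_band_def
  proof (intro conjI allI impI)
    show "lower_band n (Suc (a + b)) (F * G)" by (rule lower_band_mult[OF n bF bG])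
    fix i assume i: "i < n"
    have "unfold_mat n (F * G) i i = unfold_mat n F i i * unfold_mat n G i i"
      by (rule unfold_mat_mult_single[OF n FG]) (use zF zG in \<open>force+\<close>)
    then have "unfold_mat n (F * G) i i \<noteq> 0"
      using monic_band_unfold(1)[OF F n] monic_band_unfold(1)[OF G n] by simp
    then show "coeff ((F * G) $$ (i, i)) 0 \<noteq> 0"
      using unfold_mat_base[OF i i, of "F * G" 0] by simp
  next
    fix i j m assume ij: "i < n" "j < n" and eq: "m * n + i = j + (a + b)"
    have "unfold_mat n (F * G) (m * n + i) j
        = unfold_mat n F (m * n + i) (j + b) * unfold_mat n G (j + b) j"
    proof (rule unfold_mat_mult_single[OF n FG])
      show "j + b \<le> m * n + i" using eq by simp
      fix y assume "y \<noteq> j + b"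
      then show "unfold_mat n F (m * n + i) y * unfold_mat n G y j = 0"
        using zF[of "m * n + i" y] zG[of y j] eq by fastforce
    qed
    also have "unfold_mat n F (m * n + i) (j + b) = 1"
      using monic_band_unfold(2)[OF F n, of "j + b"] unfolding eq by (simp only: ac_simps)
    also have "unfold_mat n G (j + b) j = 1" by (rule monic_band_unfold(2)[OF G n])
    finally show "coeff ((F * G) $$ (i, j)) m = 1" unfolding unfold_mat_base[OF ij] by simp
  qed
qed

text \<open>The last diagonals consist of ones on both sides and cancel.\<close>

lemma monic_band_diff:
  fixes F G :: "'a::comm_ring_1 poly mat"
  assumes "monic_band n h F" and "monic_band n h G"
  shows "lower_band n h (F - G)"
  unfolding lower_band_def
proof (intro conjI allI impI)
  have FG: "F \<in> carrier_mat n n" "G \<in> carrier_mat n n"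
    using assms by (auto simp: monic_band_def lower_band_def)
  then show "F - G \<in> carrier_mat n n" by auto
  fix i j m assume ij: "i < n" "j < n" and "coeff ((F - G) $$ (i, j)) m \<noteq> 0"
  then have ne: "coeff (F $$ (i, j)) m \<noteq> coeff (G $$ (i, j)) m" using FG by auto
  then have nz: "coeff (F $$ (i, j)) m \<noteq> 0 \<or> coeff (G $$ (i, j)) m \<noteq> 0" by auto
  then show "j \<le> m * n + i"
    using assms ij by (auto simp: monic_band_def lower_band_def)
  have "m * n + i < j + Suc h"
    using assms ij nz by (auto simp: monic_band_def lower_band_def)
  moreover have "m * n + i \<noteq> j + h"
    using assms ij ne by (auto simp: monic_band_def)
  ultimately show "m * n + i < j + h" by auto
qed

lemma lower_band_0:
  assumes "lower_band n 0 F"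
  shows "F = 0\<^sub>m n n"
proof (rule eq_matI)
  show "dim_row F = dim_row (0\<^sub>m n n)" "dim_col F = dim_col (0\<^sub>m n n)"
    using assms by (auto simp: lower_band_def)
  fix i j assume "i < dim_row (0\<^sub>m n n :: 'a poly mat)" "j < dim_col (0\<^sub>m n n :: 'a poly mat)"
  then have ij: "i < n" "j < n" by auto
  have "coeff (F $$ (i, j)) m = 0" for m
    using assms ij unfolding lower_band_def by fastforce
  then show "F $$ (i, j) = 0\<^sub>m n n $$ (i, j)" using ij by (simp add: poly_eq_iff)
qed

text \<open>Neither end of a column of \<open>F\<close> can disappear in \<open>G * F\<close>: its lowest nonzero entry is moved
  down by \<open>h\<close> rows by the ones of \<open>G\<close>, and its highest nonzero entry stays in place because the main
  diagonal of \<open>G\<close> has no zero entry.\<close>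

lemma lower_band_cancel_left:
  fixes F G :: "'a::idom poly mat"
  assumes n: "n > 0" and G: "monic_band n h G" and F: "F \<in> carrier_mat n n"
    and GF: "lower_band n (c + h) (G * F)"
  shows "lower_band n c F"
  unfolding lower_band_def
proof (intro conjI allI impI F)
  have bG: "lower_band n (Suc h) G" using G by (auto simp: monic_band_def)
  then have cG: "G \<in> carrier_mat n n" by (auto simp: lower_band_def)
  fix i j m assume ij: "i < n" "j < n" and nz: "coeff (F $$ (i, j)) m \<noteq> 0"
  define S where "S = {y. unfold_mat n F y j \<noteq> 0}"
  have mem: "m * n + i \<in> S" using nz by (simp add: S_def unfold_mat_base[OF ij])
  \<comment> \<open>A common degree bound for column \<open>j\<close> makes its unfolded support finite.\<close>
  define d where "d = (\<Sum>i<n. degree (F $$ (i, j)))"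
  have "y < (d + 1) * n" if "y \<in> S" for y
  proof -
    have "coeff (F $$ (y mod n, j)) (y div n) \<noteq> 0" using that ij by (auto simp: S_def unfold_mat_def)
    then have "y div n \<le> degree (F $$ (y mod n, j))" by (rule le_degree)
    also have "\<dots> \<le> d" unfolding d_def using n by (intro member_le_sum) auto
    finally have "y div n < d + 1" by simp
    then show ?thesis using div_less_iff_less_mult[OF n] by blast
  qed
  then have fin: "finite S" by (meson bounded_nat_set_is_finite)
  have zero: "unfold_mat n F y j = 0" if "y \<notin> S" for y using that by (simp add: S_def)
  have nonzero: "unfold_mat n F y j \<noteq> 0" if "y \<in> S" for y using that by (simp add: S_def)
  have top: "Max S \<in> S" and bot: "Min S \<in> S" 
    using Max_in[OF fin] Min_in[OF fin] mem by blast+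
  have "unfold_mat n (G * F) (Max S + h) j = unfold_mat n G (Max S + h) (Max S) * unfold_mat n F (Max S) j"
  proof (rule unfold_mat_mult_single[OF n cG F])
    fix y assume y: "y \<noteq> Max S"
    show "unfold_mat n G (Max S + h) y * unfold_mat n F y j = 0"
    proof (cases "y \<in> S")
      case True
      then have "y < Max S" using y fin by (simp add: order_le_neq_trans)
      then show ?thesis using lower_band_unfold[OF bG n, of "Max S + h" y] by force
    qed (simp add: zero)
  qed simp
  then have "unfold_mat n (G * F) (Max S + h) j \<noteq> 0"
    using monic_band_unfold(2)[OF G n] nonzero[OF top] by simp
  from lower_band_unfold[OF GF n this] have "Max S < j + c" by simp
  then show "m * n + i < j + c" using Max_ge[OF fin mem] by simp
  have "unfold_mat n (G * F) (Min S) j = unfold_mat n G (Min S) (Min S) * unfold_mat n F (Min S) j"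
  proof (rule unfold_mat_mult_single[OF n cG F])
    fix y assume y: "y \<noteq> Min S"
    show "unfold_mat n G (Min S) y * unfold_mat n F y j = 0"
    proof (cases "y \<in> S")
      case True
      then have "Min S < y" using y fin by (simp add: order_le_neq_trans)
      then show ?thesis using lower_band_unfold[OF bG n, of "Min S" y] by force
    qed (simp add: zero)
  qed simp
  then have "unfold_mat n (G * F) (Min S) j \<noteq> 0"
    using monic_band_unfold(1)[OF G n] nonzero[OF bot] by simp
  from lower_band_unfold[OF GF n this] have "j \<le> Min S" by simp
  then show "j \<le> m * n + i" using Min_le[OF fin mem] by simp
qed

text \<open>Long division. As long as \<open>d\<close> has a nonzero entry with number \<open>b \<ge> h\<close>, the entry with the
  largest such number is removed by a multiple of the unfolded column \<open>b - h\<close> of \<open>G\<close>, which ends with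
  a one in row \<open>b\<close>.\<close>

lemma monic_band_division:
  fixes G :: "'a::comm_ring_1 poly mat"
  assumes n: "n > 0" and G: "monic_band n h G" and d: "d \<in> carrier_vec n"
  obtains q where "q \<in> carrier_vec n"
    and "\<And>i m. i < n \<Longrightarrow> coeff ((d - G *\<^sub>v q) $ i) m \<noteq> 0 \<Longrightarrow> m * n + i < h"
proof -
  have bG: "lower_band n (Suc h) G" using G by (auto simp: monic_band_def)
  then have cG: "G \<in> carrier_mat n n" by (auto simp: lower_band_def)
  have "\<exists>q\<in>carrier_vec n. \<forall>i<n. \<forall>m. coeff ((d - G *\<^sub>v q) $ i) m \<noteq> 0 \<longrightarrow> m * n + i < h"
    if "d \<in> carrier_vec n" "\<forall>i<n. \<forall>m. coeff (d $ i) m \<noteq> 0 \<longrightarrow> m * n + i < b" for b d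
    using that
  proof (induction b arbitrary: d)
    case 0
    have "G *\<^sub>v 0\<^sub>v n = 0\<^sub>v n" using cG by auto
    then show ?case using 0 by (intro bexI[of _ "0\<^sub>v n"]) auto
  next
    case (Suc b)
    show ?case
    proof (cases "b < h")
      case True
      have "G *\<^sub>v 0\<^sub>v n = 0\<^sub>v n" using cG by auto
      then show ?thesis using Suc.prems True by (intro bexI[of _ "0\<^sub>v n"]) (auto, fastforce)
    next
      case False
      \<comment> \<open>\<open>G *\<^sub>v e\<close> is the unfolded column \<open>y\<close> of \<open>G\<close>, scaled by the entry of \<open>d\<close> to be removed.\<close>
      define y where "y = b - h"
      define e where "e = vec n (\<lambda>i. if i = y mod n then monom (coeff (d $ (b mod n)) (b div n)) (y div n) else 0)"
      have e: "e \<in> carrier_vec n" by (simp add: e_def)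
      have Ge: "coeff ((G *\<^sub>v e) $ i) m = coeff (d $ (b mod n)) (b div n) * unfold_mat n G (m * n + i) y"
        if i: "i < n" for i m
      proof -
        have "(G *\<^sub>v e) $ i = (\<Sum>p<n. G $$ (i, p) * e $ p)"
          using i cG e by (auto simp: scalar_prod_def atLeast0LessThan)
        also have "\<dots> = (\<Sum>p<n. if p = y mod n then G $$ (i, p) * monom (coeff (d $ (b mod n)) (b div n)) (y div n) else 0)"
          by (intro sum.cong) (auto simp: e_def)
        also have "\<dots> = G $$ (i, y mod n) * monom (coeff (d $ (b mod n)) (b div n)) (y div n)"
          using n by (simp add: sum.delta)
        finally show ?thesis
          using i by (simp add: unfold_mat_def mult.commute[of "G $$ _"] coeff_monom_mult)
      qed
      \<comment> \<open>The entry number \<open>b\<close> of \<open>d'\<close> vanishes, and later entries do not appear.\<close>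
      define d' where "d' = d - G *\<^sub>v e"
      have d': "d' \<in> carrier_vec n" using Suc.prems(1) cG e by (auto simp: d'_def)
      have "\<forall>i<n. \<forall>m. coeff (d' $ i) m \<noteq> 0 \<longrightarrow> m * n + i < b"
      proof (intro allI impI)
        fix i m assume i: "i < n" and nz: "coeff (d' $ i) m \<noteq> 0"
        have eq: "coeff (d' $ i) m = coeff (d $ i) m - coeff (d $ (b mod n)) (b div n) * unfold_mat n G (m * n + i) y"
          using i cG Ge[OF i] Suc.prems(1) e by (simp add: d'_def)
        have "m * n + i \<noteq> b"
        proof
          assume b: "m * n + i = b"
          then have "b mod n = i" "b div n = m" using i by auto
          moreover have "unfold_mat n G (m * n + i) y = 1"
            using monic_band_unfold(2)[OF G n, of y] False b by (simp add: y_def)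
          ultimately show False using nz eq by simp
        qed
        moreover have "m * n + i < Suc b"
        proof (cases "coeff (d $ i) m = 0")
          case True
          then have "unfold_mat n G (m * n + i) y \<noteq> 0" using nz eq by auto
          from lower_band_unfold[OF bG n this] show ?thesis using False by (auto simp: y_def)
        qed (use Suc.prems(2) i in auto)
        ultimately show "m * n + i < b" by simp
      qed
      from Suc.IH[OF d' this] obtain q where q: "q \<in> carrier_vec n"
        and r: "\<forall>i<n. \<forall>m. coeff ((d' - G *\<^sub>v q) $ i) m \<noteq> 0 \<longrightarrow> m * n + i < h" by blast
      have "d' - G *\<^sub>v q = d - G *\<^sub>v (e + q)"
        using Suc.prems(1) cG e q by (auto simp: d'_def mult_add_distrib_mat_vec[OF cG e q])
      then show ?thesis using r e q by (intro bexI[of _ "e + q"]) auto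
    qed
  qed
  moreover define b where "b = (\<Sum>i<n. degree (d $ i) + 1) * n"
  have "m * n + i < b" if "i < n" "coeff (d $ i) m \<noteq> 0" for i m
  proof -
    have "m \<le> degree (d $ i)" using that(2) by (rule le_degree)
    then have "m + 1 \<le> degree (d $ i) + 1" by simp
    also have "\<dots> \<le> (\<Sum>i<n. degree (d $ i) + 1)" using that by (intro member_le_sum) auto
    finally have "(m + 1) * n \<le> b" unfolding b_def by (rule mult_right_mono) simp
    then show ?thesis using that by simp
  qed
  ultimately show ?thesis using that d by blast
qed

section \<open>Specialisation of the indeterminate and reflection in the anti-diagonal\<close>

definition eval_mat :: "'a::comm_ring_1 \<Rightarrow> 'a poly mat \<Rightarrow> 'a mat" where
  "eval_mat z F = map_mat (\<lambda>p. poly p z) F"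

lemma eval_mat_carrier [simp]: "eval_mat z F \<in> carrier_mat m n \<longleftrightarrow> F \<in> carrier_mat m n"
  by (simp add: eval_mat_def)

lemma eval_mat_mult:
  assumes "F \<in> carrier_mat m n" and "G \<in> carrier_mat n p"
  shows "eval_mat z (F * G) = eval_mat z F * eval_mat z G"
proof -
  interpret semiring_hom "\<lambda>p. poly p z" by unfold_locales auto
  show ?thesis unfolding eval_mat_def by (rule mat_hom_mult[OF assms])
qed

lemma eval_mat_minus:
  assumes "F \<in> carrier_mat m n" and "G \<in> carrier_mat m n"
  shows "eval_mat z (F - G) = eval_mat z F - eval_mat z G"
  using assms by (intro eq_matI) (auto simp: eval_mat_def)

lemma flip_mat_carrier [simp]: "flip_mat n F \<in> carrier_mat n n"
  by (simp add: flip_mat_def)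

lemma flip_mat_flip_mat: "F \<in> carrier_mat n n \<Longrightarrow> flip_mat n (flip_mat n F) = F"
  by (intro eq_matI) (auto simp: flip_mat_def)

lemma eval_mat_flip_mat:
  "F \<in> carrier_mat n n \<Longrightarrow> eval_mat z (flip_mat n F) = flip_mat n (eval_mat z F)"
  by (intro eq_matI) (auto simp: flip_mat_def eval_mat_def)

text \<open>Reflection does not increase the rank: a factorisation through dimension \<open>k\<close> is reflected to
  another one.\<close>

lemma flip_mat_factor:
  fixes M :: "'a::comm_semiring_0 mat"
  assumes "M \<in> carrier_mat n k" and "C \<in> carrier_mat k n"
  shows "flip_mat n (M * C) =
    mat n k (\<lambda>(i, j). C $$ (j, n - 1 - i)) * mat k n (\<lambda>(i, j). M $$ (n - 1 - j, i))"
proof (rule eq_matI)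
  fix i j assume "i < dim_row (mat n k (\<lambda>(i, j). C $$ (j, n - 1 - i)) * mat k n (\<lambda>(i, j). M $$ (n - 1 - j, i)))"
    and "j < dim_col (mat n k (\<lambda>(i, j). C $$ (j, n - 1 - i)) * mat k n (\<lambda>(i, j). M $$ (n - 1 - j, i)))"
  then have ij: "i < n" "j < n" by auto
  then have "n - 1 - i < n" "n - 1 - j < n" by auto
  then show "flip_mat n (M * C) $$ (i, j) =
    (mat n k (\<lambda>(i, j). C $$ (j, n - 1 - i)) * mat k n (\<lambda>(i, j). M $$ (n - 1 - j, i))) $$ (i, j)"
    using ij assms by (auto simp: flip_mat_def scalar_prod_def mult.commute intro!: sum.cong)
qed (simp_all add: flip_mat_def)

lemma flip_mat_mult:
  fixes F :: "'a::comm_semiring_0 mat"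
  assumes "F \<in> carrier_mat n n" and "G \<in> carrier_mat n n"
  shows "flip_mat n (F * G) = flip_mat n G * flip_mat n F"
  using assms
proof (intro eq_matI)
  fix i j assume "i < dim_row (flip_mat n G * flip_mat n F)" "j < dim_col (flip_mat n G * flip_mat n F)"
  then have ij: "i < n" "j < n" by (auto simp: flip_mat_def)
  have "flip_mat n (F * G) $$ (i, j) = (\<Sum>p<n. F $$ (n - 1 - j, p) * G $$ (p, n - 1 - i))"
    using assms ij by (simp add: flip_mat_def scalar_prod_def atLeast0LessThan)
  also have "\<dots> = (\<Sum>p<n. G $$ (n - 1 - p, n - 1 - i) * F $$ (n - 1 - j, n - 1 - p))"
    by (rule sum.reindex_bij_witness[of _ "\<lambda>p. n - 1 - p" "\<lambda>p. n - 1 - p"]) (auto simp: mult.commute)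
  also have "\<dots> = (flip_mat n G * flip_mat n F) $$ (i, j)"
    using assms ij by (simp add: flip_mat_def scalar_prod_def atLeast0LessThan)
  finally show "flip_mat n (F * G) $$ (i, j) = (flip_mat n G * flip_mat n F) $$ (i, j)" .
qed (auto simp: flip_mat_def)

lemma flip_mat_minus:
  assumes "F \<in> carrier_mat n n" and "G \<in> carrier_mat n n"
  shows "flip_mat n (F - G) = flip_mat n F - flip_mat n G"
proof (rule eq_matI)
  fix i j assume "i < dim_row (flip_mat n F - flip_mat n G)" "j < dim_col (flip_mat n F - flip_mat n G)"
  then have ij: "i < n" "j < n" by (auto simp: flip_mat_def)
  then have "n - 1 - i < dim_col G" "n - 1 - j < dim_row G" using assms by auto
  then show "flip_mat n (F - G) $$ (i, j) = (flip_mat n F - flip_mat n G) $$ (i, j)"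
    using ij by (simp add: flip_mat_def)
qed (simp_all add: flip_mat_def)

text \<open>Reflection preserves \<open>m * n + i - j\<close>, hence every diagonal of the unfolded matrix.\<close>

lemma lower_band_flip_mat:
  assumes "lower_band n c F"
  shows "lower_band n c (flip_mat n F)"
  unfolding lower_band_def
proof (intro conjI allI impI flip_mat_carrier)
  have bound: "j \<le> m * n + i \<and> m * n + i < j + c"
    if "i < n" "j < n" "coeff (F $$ (i, j)) m \<noteq> 0" for i j m
    using assms that unfolding lower_band_def by blast
  fix i j m assume ij: "i < n" "j < n" and "coeff (flip_mat n F $$ (i, j)) m \<noteq> 0"
  then have "coeff (F $$ (n - 1 - j, n - 1 - i)) m \<noteq> 0" by (simp add: flip_mat_def)
  then have "n - 1 - i \<le> m * n + (n - 1 - j)" "m * n + (n - 1 - j) < n - 1 - i + c"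
    using bound[of "n - 1 - j" "n - 1 - i" m] ij by simp_all
  then show "j \<le> m * n + i" "m * n + i < j + c" using ij by linarith+
qed

lemma monic_band_flip_mat:
  assumes "monic_band n h F"
  shows "monic_band n h (flip_mat n F)"
  unfolding monic_band_def
proof (intro conjI allI impI)
  show "lower_band n (Suc h) (flip_mat n F)"
    using assms by (simp add: monic_band_def lower_band_flip_mat)
  fix i assume "i < n"
  then show "coeff (flip_mat n F $$ (i, i)) 0 \<noteq> 0"
    using assms by (simp add: flip_mat_def monic_band_def)
next
  fix i j m assume ij: "i < n" "j < n" and "m * n + i = j + h"
  then have "m * n + (n - 1 - j) = n - 1 - i + h" by linarith
  then show "coeff (flip_mat n F $$ (i, j)) m = 1"
    using assms ij by (simp add: flip_mat_def monic_band_def)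
qed

section \<open>Column spaces\<close>

lemma minus_mat_eq_0D:
  fixes A B :: "'a::ab_group_add mat"
  assumes "A \<in> carrier_mat m n" and "B \<in> carrier_mat m n" and 0: "A - B = 0\<^sub>m m n"
  shows "A = B"
proof (rule eq_matI)
  fix i j assume ij: "i < dim_row B" "j < dim_col B"
  then have "(A - B) $$ (i, j) = A $$ (i, j) - B $$ (i, j)" by simp
  moreover have "(A - B) $$ (i, j) = 0" unfolding 0 using ij assms(2) by simp
  ultimately show "A $$ (i, j) = B $$ (i, j)" by simp
qed (use assms in auto)

definition cols_in :: "complex mat \<Rightarrow> complex vec set \<Rightarrow> bool" where
  "cols_in X N \<longleftrightarrow> (\<forall>j < dim_col X. col X j \<in> N)"

definition injective_mat :: "nat \<Rightarrow> complex mat \<Rightarrow> bool" where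
  "injective_mat k W \<longleftrightarrow> (\<forall>y \<in> carrier_vec k. W *\<^sub>v y = 0\<^sub>v (dim_row W) \<longrightarrow> y = 0\<^sub>v k)"

lemma mem_col_space:
  fixes M :: "complex mat"
  assumes "M \<in> carrier_mat n k"
  shows "v \<in> vec_space.col_space n M \<longleftrightarrow> (\<exists>c\<in>carrier_vec k. v = M *\<^sub>v c)"
proof -
  have "M *\<^sub>v c \<in> carrier_vec n" if "c \<in> carrier_vec k" for c
    using assms that by (rule mult_mat_vec_carrier)
  moreover have "dim_row M = n" "dim_col M = k" using assms by auto
  ultimately show ?thesis unfolding vec_space.col_space_eq[OF assms] by blast
qed

lemma cols_in_col_space:
  assumes M: "M \<in> carrier_mat n k" and X: "X \<in> carrier_mat n p"
  shows "cols_in X (vec_space.col_space n M) \<longleftrightarrow> (\<exists>C\<in>carrier_mat k p. X = M * C)"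
proof
  assume "cols_in X (vec_space.col_space n M)"
  then have "\<forall>j\<in>{..<p}. \<exists>c. c \<in> carrier_vec k \<and> col X j = M *\<^sub>v c"
    using X unfolding cols_in_def mem_col_space[OF M] by auto
  then obtain c where c: "\<And>j. j < p \<Longrightarrow> c j \<in> carrier_vec k \<and> col X j = M *\<^sub>v c j"
    by (metis lessThan_iff)
  define C where "C = mat k p (\<lambda>(i, j). c j $ i)"
  have "X = M * C"
  proof (rule eq_matI)
    fix i j assume ij: "i < dim_row (M * C)" "j < dim_col (M * C)"
    then have j: "j < p" and i: "i < n" using M by (auto simp: C_def)
    have "col C j = c j" using c[OF j] j by (auto simp: C_def)
    then have "(M * C) $$ (i, j) = (M *\<^sub>v c j) $ i" using ij by simp
    also have "\<dots> = X $$ (i, j)" using c[OF j] i j X by (metis carrier_matD index_col)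
    finally show "X $$ (i, j) = (M * C) $$ (i, j)" ..
  qed (use M X in \<open>auto simp: C_def\<close>)
  then show "\<exists>C\<in>carrier_mat k p. X = M * C" by (intro bexI[of _ C]) (auto simp: C_def)
next
  assume "\<exists>C\<in>carrier_mat k p. X = M * C"
  then obtain C where C: "C \<in> carrier_mat k p" "X = M * C" by blast
  show "cols_in X (vec_space.col_space n M)"
    unfolding cols_in_def mem_col_space[OF M]
  proof (intro allI impI)
    fix j assume "j < dim_col X"
    then have "col X j = M *\<^sub>v col C j" using C M by (auto intro: col_mult2)
    moreover have "col C j \<in> carrier_vec k" using C(1) by (intro carrier_vecI) simp
    ultimately show "\<exists>c\<in>carrier_vec k. col X j = M *\<^sub>v c" by blast
  qed
qed

lemma cols_in_mult:
  assumes "M \<in> carrier_mat n k" and "C \<in> carrier_mat k p"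
  shows "cols_in (M * C) (vec_space.col_space n M)"
proof -
  have "M * C \<in> carrier_mat n p" using assms by simp
  from cols_in_col_space[OF assms(1) this] show ?thesis using assms(2) by blast
qed

text \<open>Otherwise \<open>Y\<close> has fewer rows than columns; padded with zero rows it is a singular square
  matrix, and a kernel vector of it is annihilated by \<open>W\<close>.\<close>

lemma injective_mat_factor_le:
  assumes W: "injective_mat k W" and eq: "W = P * Y"
    and P: "P \<in> carrier_mat n l" and Y: "Y \<in> carrier_mat l k"
  shows "k \<le> l"
proof (rule ccontr)
  assume "\<not> k \<le> l"
  then have lk: "l < k" by simp
  define Y' where "Y' = mat k k (\<lambda>(i, j). if i < l then Y $$ (i, j) else 0)"
  have Y': "Y' \<in> carrier_mat k k" by (simp add: Y'_def)
  have "det Y' = (\<Sum>j<k. Y' $$ (l, j) * cofactor Y' l j)" by (rule laplace_expansion_row[OF Y' lk])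
  also have "\<dots> = 0" using lk by (intro sum.neutral) (auto simp: Y'_def)
  finally obtain v where v: "v \<in> carrier_vec k" "v \<noteq> 0\<^sub>v k" "Y' *\<^sub>v v = 0\<^sub>v k"
    using det_0_iff_vec_prod_zero[OF Y'] by blast
  have "Y *\<^sub>v v = 0\<^sub>v l"
  proof (rule eq_vecI)
    fix i assume "i < dim_vec (0\<^sub>v l :: complex vec)"
    then have i: "i < l" by simp
    then have "row Y i = row Y' i" using lk Y by (auto simp: Y'_def)
    then have "(Y *\<^sub>v v) $ i = (Y' *\<^sub>v v) $ i" using i lk Y Y' by simp
    then show "(Y *\<^sub>v v) $ i = 0\<^sub>v l $ i" using v i lk by simp
  qed (use Y in auto)
  then have "W *\<^sub>v v = 0\<^sub>v (dim_row W)"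
    using eq P Y v by (auto simp: assoc_mult_mat_vec[OF P Y v(1)])
  then show False using W v by (auto simp: injective_mat_def)
qed

text \<open>If the \<open>k\<close> columns of \<open>W\<close> are independent and lie in a space spanned by \<open>k\<close> vectors, then they
  span it: here \<open>Y\<close> has trivial kernel, so it can be inverted.\<close>

lemma injective_mat_factor:
  assumes W: "injective_mat k W" and eq: "W = P * Y"
    and P: "P \<in> carrier_mat n k" and Y: "Y \<in> carrier_mat k k"
  obtains Z where "Z \<in> carrier_mat k k" and "P = W * Z"
proof -
  have "det Y \<noteq> 0"
  proof
    assume "det Y = 0"
    then obtain v where v: "v \<in> carrier_vec k" "v \<noteq> 0\<^sub>v k" "Y *\<^sub>v v = 0\<^sub>v k"
      using det_0_iff_vec_prod_zero[OF Y] by blast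
    then have "W *\<^sub>v v = 0\<^sub>v (dim_row W)"
      using eq P Y by (auto simp: assoc_mult_mat_vec[OF P Y v(1)])
    then show False using W v by (auto simp: injective_mat_def)
  qed
  then obtain Z where Z: "Z \<in> carrier_mat k k" "Y * Z = 1\<^sub>m k"
    using det_non_zero_imp_unit[OF Y, of "()"] unfolding Units_def ring_mat_simps by blast
  have "W * Z = P * (Y * Z)" unfolding eq by (rule assoc_mult_mat[OF P Y Z(1)])
  then have "P = W * Z" using Z P by simp
  then show ?thesis using that Z by blast
qed

section \<open>Division by a monic band matrix adapted to a subspace\<close>

text \<open>The properties of \<open>G = g(N|t)\<close> at \<open>z = (-1)\<^sup>k\<^sup>-\<^sup>1 t\<close> that determine how it divides other matrices.
  The last one says that the projection of \<open>N\<close> to the last \<open>k\<close> coordinates is injective, which is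
  \<open>P\<^bsub>[n-k+1,n]\<^esub>(N) \<noteq> 0\<close>.\<close>

definition adapted :: "nat \<Rightarrow> nat \<Rightarrow> complex \<Rightarrow> complex vec set \<Rightarrow> complex poly mat \<Rightarrow> bool" where
  "adapted n k z N G \<longleftrightarrow> monic_band n (n - k) G \<and> cols_in (eval_mat z G) N \<and>
     (\<exists>M \<in> carrier_mat n k. N = vec_space.col_space n M) \<and>
     (\<forall>x \<in> N. (\<forall>i. n - k \<le> i \<and> i < n \<longrightarrow> x $ i = 0) \<longrightarrow> x = 0\<^sub>v n)"

lemma adapted_carrier: "adapted n k z N G \<Longrightarrow> G \<in> carrier_mat n n"
  by (simp add: adapted_def monic_band_def lower_band_def)

lemma adapted_factor:
  assumes "adapted n k z N G"
  obtains M C where "M \<in> carrier_mat n k" and "N = vec_space.col_space n M"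
    and "C \<in> carrier_mat k n" and "eval_mat z G = M * C"
proof -
  obtain M where M: "M \<in> carrier_mat n k" "N = vec_space.col_space n M"
    using assms unfolding adapted_def by blast
  have "cols_in (eval_mat z G) (vec_space.col_space n M)"
    using assms M by (simp add: adapted_def)
  then obtain C where "C \<in> carrier_mat k n" "eval_mat z G = M * C"
    using cols_in_col_space[OF M(1), of "eval_mat z G" n] adapted_carrier[OF assms] by auto
  then show ?thesis using that M by blast
qed

lemma cols_in_mult_right:
  assumes M: "M \<in> carrier_mat n k" and X: "X \<in> carrier_mat n p" and Y: "Y \<in> carrier_mat p q"
    and "cols_in X (vec_space.col_space n M)"
  shows "cols_in (X * Y) (vec_space.col_space n M)"
proof -
  obtain C where C: "C \<in> carrier_mat k p" "X = M * C"
    using assms cols_in_col_space[OF M X] by blast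
  then have "X * Y = M * (C * Y)" using M Y by simp
  moreover have "C * Y \<in> carrier_mat k q" using C(1) Y by simp
  ultimately show ?thesis using cols_in_mult[OF M] by simp
qed

lemma cols_in_minus:
  assumes M: "M \<in> carrier_mat n k" and X: "X \<in> carrier_mat n p" and Y: "Y \<in> carrier_mat n p"
    and "cols_in X (vec_space.col_space n M)" and "cols_in Y (vec_space.col_space n M)"
  shows "cols_in (X - Y) (vec_space.col_space n M)"
proof -
  obtain C where C: "C \<in> carrier_mat k p" "X = M * C"
    using assms cols_in_col_space[OF M X] by blast
  obtain C' where C': "C' \<in> carrier_mat k p" "Y = M * C'"
    using assms cols_in_col_space[OF M Y] by blast
  have "X - Y = M * (C - C')" unfolding C(2) C'(2)
    by (rule mult_minus_distrib_mat[OF M C(1) C'(1), symmetric])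
  moreover have "C - C' \<in> carrier_mat k p" using C'(1) by (rule minus_carrier_mat)
  ultimately show ?thesis using cols_in_mult[OF M] by simp
qed

text \<open>The remainder of each column is a constant vector supported on the first \<open>n - k\<close> rows, and its
  value at \<open>z\<close> lies in \<open>N\<close>; so it is zero.\<close>

lemma adapted_division:
  assumes n: "n > 0" and k: "k \<le> n" and G: "adapted n k z N G" and D: "D \<in> carrier_mat n n"
    and DN: "cols_in (eval_mat z D) N"
  obtains E where "E \<in> carrier_mat n n" and "D = G * E"
proof -
  obtain M C where M: "M \<in> carrier_mat n k" "N = vec_space.col_space n M"
    and C: "C \<in> carrier_mat k n" "eval_mat z G = M * C" using adapted_factor[OF G] .
  have cG: "G \<in> carrier_mat n n" by (rule adapted_carrier[OF G])
  have band: "monic_band n (n - k) G" using G by (simp add: adapted_def)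
  have "\<exists>q. q \<in> carrier_vec n \<and> col D j = G *\<^sub>v q" if j: "j < n" for j
  proof -
    have dj: "col D j \<in> carrier_vec n" using D by auto
    obtain q where q: "q \<in> carrier_vec n"
      and r: "\<And>i m. i < n \<Longrightarrow> coeff ((col D j - G *\<^sub>v q) $ i) m \<noteq> 0 \<Longrightarrow> m * n + i < n - k"
      using monic_band_division[OF n band dj] by blast
    define r where "r = col D j - G *\<^sub>v q"
    have cr: "r \<in> carrier_vec n" using D cG q by (auto simp: r_def)
    have const: "coeff (r $ i) m = 0" if "i < n" "m > 0 \<or> n - k \<le> i" for i m
    proof (rule ccontr)
      assume "coeff (r $ i) m \<noteq> 0"
      then have lt: "m * n + i < n - k" using r[OF that(1)] by (simp add: r_def)
      moreover have "m > 0 \<Longrightarrow> n \<le> m * n" by simp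
      ultimately show False using that k by linarith
    qed
    define x where "x = map_vec (\<lambda>p. poly p z) r"
    define y where "y = map_vec (\<lambda>p. poly p z) q"
    have cy: "y \<in> carrier_vec n" using q by (simp add: y_def)
    have "x = col (eval_mat z D) j - eval_mat z G *\<^sub>v y"
    proof (rule eq_vecI)
      fix i assume "i < dim_vec (col (eval_mat z D) j - eval_mat z G *\<^sub>v y)"
      then have i: "i < n" using cG by (simp add: eval_mat_def)
      have "x $ i = poly (D $$ (i, j) - (\<Sum>p<n. G $$ (i, p) * q $ p)) z"
        using i j D cG q by (simp add: x_def r_def scalar_prod_def atLeast0LessThan)
      also have "\<dots> = (col (eval_mat z D) j - eval_mat z G *\<^sub>v y) $ i"
        using i j D cG q by (simp add: y_def eval_mat_def scalar_prod_def atLeast0LessThan poly_sum)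
      finally show "x $ i = (col (eval_mat z D) j - eval_mat z G *\<^sub>v y) $ i" .
    qed (use cr cG in \<open>simp add: x_def eval_mat_def\<close>)
    moreover have "\<exists>c\<in>carrier_vec k. col (eval_mat z D) j = M *\<^sub>v c"
      using DN j D unfolding cols_in_def M(2) mem_col_space[OF M(1)] by (simp add: eval_mat_def)
    then obtain c where c: "c \<in> carrier_vec k" "col (eval_mat z D) j = M *\<^sub>v c" by blast
    moreover have "eval_mat z G *\<^sub>v y = M *\<^sub>v (C *\<^sub>v y)"
      unfolding C(2) by (rule assoc_mult_mat_vec[OF M(1) C(1) cy])
    moreover have Cy: "C *\<^sub>v y \<in> carrier_vec k" by (rule mult_mat_vec_carrier[OF C(1) cy])
    ultimately have "x = M *\<^sub>v (c - C *\<^sub>v y)"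
      by (simp add: mult_minus_distrib_mat_vec[OF M(1) c(1) Cy])
    then have xN: "x \<in> N" unfolding M(2) mem_col_space[OF M(1)] using c Cy by auto
    have "x $ i = 0" if "n - k \<le> i" "i < n" for i
    proof -
      have "r $ i = 0" using const[OF that(2)] that(1) by (simp add: poly_eq_iff)
      then show ?thesis using that cr by (simp add: x_def)
    qed
    then have x0: "x = 0\<^sub>v n" using G xN unfolding adapted_def by blast
    have "r = 0\<^sub>v n"
    proof (rule eq_vecI)
      fix i assume "i < dim_vec (0\<^sub>v n :: complex poly vec)"
      then have i: "i < n" by simp
      have "degree (r $ i) = 0" using const[OF i] degree_le[of 0 "r $ i"] by simp
      then obtain a where a: "r $ i = [:a:]" by (rule degree_eq_zeroE)
      have "x $ i = 0" using x0 i by simp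
      then have "a = 0" using a i cr by (simp add: x_def)
      then show "r $ i = 0\<^sub>v n $ i" using a i by simp
    qed (use cr in simp)
    then have "col D j = G *\<^sub>v q"
    proof -
      have Gq: "G *\<^sub>v q \<in> carrier_vec n" using cG q by auto
      have "col D j = r + G *\<^sub>v q"
        unfolding r_def using D cG by (intro eq_vecI) simp_all
      then show ?thesis using \<open>r = 0\<^sub>v n\<close> Gq by simp
    qed
    then show ?thesis using q by blast
  qed
  then obtain q where q: "\<And>j. j < n \<Longrightarrow> q j \<in> carrier_vec n \<and> col D j = G *\<^sub>v q j" by metis
  define E where "E = mat n n (\<lambda>(i, j). q j $ i)"
  have E: "E \<in> carrier_mat n n" by (simp add: E_def)
  have "D = G * E"
  proof (rule eq_matI)
    fix i j assume "i < dim_row (G * E)" "j < dim_col (G * E)"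
    then have ij: "i < n" "j < n" using cG E by auto
    have "col E j = q j" using q[OF ij(2)] ij by (auto simp: E_def)
    then have "(G * E) $$ (i, j) = (G *\<^sub>v q j) $ i" using ij cG E by simp
    also have "\<dots> = col D j $ i" using q[OF ij(2)] by simp
    also have "\<dots> = D $$ (i, j)" using ij D by simp
    finally show "D $$ (i, j) = (G * E) $$ (i, j)" ..
  qed (use D cG E in auto)
  then show ?thesis using that E by blast
qed

text \<open>The difference of the two matrices has one diagonal less than \<open>G\<close>, and it is divisible by
  \<open>G\<close>; so the quotient has no diagonal at all.\<close>

lemma adapted_unique:
  assumes n: "n > 0" and k: "k \<le> n" and G: "adapted n k z N G"
    and H: "monic_band n (n - k) H" and HN: "cols_in (eval_mat z H) N"
  shows "H = G"
proof -
  obtain M where M: "M \<in> carrier_mat n k" "N = vec_space.col_space n M"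
    using adapted_factor[OF G] by metis
  have cG: "G \<in> carrier_mat n n" by (rule adapted_carrier[OF G])
  have cH: "H \<in> carrier_mat n n" using H by (simp add: monic_band_def lower_band_def)
  have mG: "monic_band n (n - k) G" and GN: "cols_in (eval_mat z G) N"
    using G by (simp_all add: adapted_def)
  have "cols_in (eval_mat z (H - G)) N"
    unfolding eval_mat_minus[OF cH cG] M(2)
    by (rule cols_in_minus[OF M(1)]) (use cH cG HN GN M(2) in simp_all)
  moreover have "H - G \<in> carrier_mat n n" using cG by (rule minus_carrier_mat)
  ultimately obtain E where E: "E \<in> carrier_mat n n" "H - G = G * E"
    using adapted_division[OF n k G] by blast
  have "lower_band n (0 + (n - k)) (G * E)"
    using monic_band_diff[OF H mG] E(2) by simp
  then have "E = 0\<^sub>m n n" using lower_band_0 lower_band_cancel_left[OF n mG E(1)] by blast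
  then have "H - G = 0\<^sub>m n n" using E cG by simp
  then show "H = G" by (rule minus_mat_eq_0D[OF cH cG])
qed

text \<open>The matrix \<open>(\<lambda> - z) 1\<close> vanishes at \<open>z\<close>, so it is a multiple of \<open>G\<close>; dividing by \<open>y - z\<close> gives the
  inverse of the value of \<open>G\<close> at \<open>y\<close>.\<close>

lemma adapted_eval_invertible:
  assumes n: "n > 0" and k: "k \<le> n" and G: "adapted n k z N G" and y: "y \<noteq> z"
  obtains Q where "Q \<in> carrier_mat n n" and "eval_mat y G * Q = 1\<^sub>m n" and "Q * eval_mat y G = 1\<^sub>m n"
proof -
  obtain M where M: "M \<in> carrier_mat n k" "N = vec_space.col_space n M"
    using adapted_factor[OF G] by metis
  have cG: "G \<in> carrier_mat n n" by (rule adapted_carrier[OF G])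
  define D where "D = [:- z, 1:] \<cdot>\<^sub>m (1\<^sub>m n :: complex poly mat)"
  have D: "D \<in> carrier_mat n n" by (simp add: D_def)
  have eval: "eval_mat w D = (w - z) \<cdot>\<^sub>m 1\<^sub>m n" for w
    by (rule eq_matI) (auto simp: D_def eval_mat_def)
  have "eval_mat z D = M * 0\<^sub>m k n" unfolding eval using M(1) by auto
  then have "cols_in (eval_mat z D) N"
    using cols_in_mult[OF M(1) zero_carrier_mat[of k n]] M(2) by simp
  then obtain E where E: "E \<in> carrier_mat n n" "D = G * E"
    using adapted_division[OF n k G D] by blast
  define Q where "Q = (1 / (y - z)) \<cdot>\<^sub>m eval_mat y E"
  have Q: "Q \<in> carrier_mat n n" using E by (simp add: Q_def)
  have "eval_mat y G * Q = (1 / (y - z)) \<cdot>\<^sub>m (eval_mat y G * eval_mat y E)"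
    unfolding Q_def using cG E by (intro mult_smult_distrib) auto
  also have "eval_mat y G * eval_mat y E = (y - z) \<cdot>\<^sub>m 1\<^sub>m n"
    using eval_mat_mult[OF cG E(1)] E(2) eval by metis
  finally have 1: "eval_mat y G * Q = 1\<^sub>m n" using y by (intro eq_matI) auto
  have "Q * eval_mat y G = 1\<^sub>m n"
    by (rule mat_mult_left_right_inverse[OF _ Q 1]) (use cG in simp)
  then show ?thesis using that Q 1 by blast
qed

section \<open>Pluecker coordinates and the matrix of a point\<close>

text \<open>The rows \<open>q\<close> with one more row inserted at position \<open>p\<close>, expanded along the inserted row: the
  minors only involve the rows \<open>q\<close>, so apart from the sign the coefficients do not depend on \<open>p\<close>.\<close>

lemma det_expand_inserted_row:
  fixes M :: "'a::comm_ring_1 mat"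
  assumes p: "p < k" and r: "\<And>a. a < k - 1 \<Longrightarrow> r (insert_index p a) = q a"
  shows "det (mat k k (\<lambda>(a, c). M $$ (r a, c))) = (-1) ^ p *
    (\<Sum>c<k. M $$ (r p, c) *
      ((-1) ^ c * det (mat (k - 1) (k - 1) (\<lambda>(a, b). M $$ (q a, insert_index c b)))))"
proof -
  define R where "R = mat k k (\<lambda>(a, c). M $$ (r a, c))"
  have R: "R \<in> carrier_mat k k" by (simp add: R_def)
  have del: "mat_delete R p c = mat (k - 1) (k - 1) (\<lambda>(a, b). M $$ (q a, insert_index c b))"
    if c: "c < k" for c
  proof (rule eq_matI)
    fix a b assume "a < dim_row (mat (k - 1) (k - 1) (\<lambda>(a, b). M $$ (q a, insert_index c b)))"
      and "b < dim_col (mat (k - 1) (k - 1) (\<lambda>(a, b). M $$ (q a, insert_index c b)))"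
    then have ab: "a < k - 1" "b < k - 1" by auto
    then have "insert_index p a < k" "insert_index c b < k" by (auto simp: insert_index_def)
    then show "mat_delete R p c $$ (a, b) =
      mat (k - 1) (k - 1) (\<lambda>(a, b). M $$ (q a, insert_index c b)) $$ (a, b)"
      using ab r[OF ab(1)] by (simp add: mat_delete_def R_def insert_index_def)
  qed (simp_all add: mat_delete_def R_def)
  have "det R = (\<Sum>c<k. R $$ (p, c) * cofactor R p c)" by (rule laplace_expansion_row[OF R p])
  also have "\<dots> = (\<Sum>c<k. (-1) ^ p * (M $$ (r p, c) *
      ((-1) ^ c * det (mat (k - 1) (k - 1) (\<lambda>(a, b). M $$ (q a, insert_index c b))))))"
  proof (rule sum.cong[OF refl])
    fix c assume "c \<in> {..<k}"
    then have c: "c < k" by simp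
    have "R $$ (p, c) = M $$ (r p, c)" using c p by (simp add: R_def)
    then show "R $$ (p, c) * cofactor R p c = (-1) ^ p * (M $$ (r p, c) *
      ((-1) ^ c * det (mat (k - 1) (k - 1) (\<lambda>(a, b). M $$ (q a, insert_index c b)))))"
      unfolding cofactor_def del[OF c] power_add by (simp only: ac_simps)
  qed
  finally show ?thesis unfolding R_def by (simp only: sum_distrib_left)
qed

text \<open>Applying \<open>M\<close> to this vector yields, up to signs, the maximal minors of \<open>M\<close> with rows \<open>J \<union> {i}\<close>,
  for all \<open>i\<close> at once. This exhibits them as the coordinates of a vector in the column space.\<close>

definition minor_vec :: "nat \<Rightarrow> 'a::comm_ring_1 mat \<Rightarrow> nat set \<Rightarrow> 'a vec" where
  "minor_vec k M J = vec k (\<lambda>c. (-1) ^ c *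
     det (mat (k - 1) (k - 1) (\<lambda>(a, b). M $$ (pick J a, insert_index c b))))"

lemma mult_minor_vec:
  assumes M: "M \<in> carrier_mat n k" and i: "i < n"
  shows "(M *\<^sub>v minor_vec k M J) $ i = (\<Sum>c<k. M $$ (i, c) *
      ((-1) ^ c * det (mat (k - 1) (k - 1) (\<lambda>(a, b). M $$ (pick J a, insert_index c b)))))"
  using M i by (simp add: minor_vec_def scalar_prod_def atLeast0LessThan)

text \<open>Listed in increasing order, the rows of \<open>insert i J\<close> are those of \<open>J\<close> with \<open>i\<close> inserted at the
  position given by the number of smaller elements.\<close>

lemma pick_insert_index:
  assumes J: "finite J" and i: "i \<notin> J" and a: "a < card J"
  shows "pick (insert i J) (insert_index (card {b \<in> J. b < i}) a) = pick J a"
proof -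
  define y where "y = pick J a"
  have y: "y \<in> J" "card {b \<in> J. b < y} = a"
    using a pick_in_set_le card_pick_le by (auto simp: y_def)
  have "card {b \<in> insert i J. b < y} = insert_index (card {b \<in> J. b < i}) a"
  proof (cases "i < y")
    case True
    then have "card {b \<in> J. b < i} \<le> card {b \<in> J. b < y}" using J by (intro card_mono) auto
    moreover have "{b \<in> insert i J. b < y} = insert i {b \<in> J. b < y}" using True by auto
    ultimately show ?thesis using y i J by (simp add: insert_index_def)
  next
    case False
    then have "y < i" using y i by (metis linorder_neqE_nat)
    then have "card (insert y {b \<in> J. b < y}) \<le> card {b \<in> J. b < i}"
      using J y by (intro card_mono) auto
    then have "a < card {b \<in> J. b < i}" using J y by simp
    moreover have "{b \<in> insert i J. b < y} = {b \<in> J. b < y}" using False by auto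
    ultimately show ?thesis using y by (simp add: insert_index_def)
  qed
  then show ?thesis using pick_card_in_set[of y "insert i J"] y by (simp add: y_def)
qed

lemma submatrix_rows:
  assumes M: "M \<in> carrier_mat n k" and I: "I \<subseteq> {..<n}" "card I = k"
  shows "submatrix M I UNIV = mat k k (\<lambda>(a, c). M $$ (pick I a, c))"
proof -
  have "{i. i < n \<and> i \<in> I} = I" using I by auto
  then show ?thesis using M I by (auto simp: submatrix_def pick_UNIV)
qed

lemma minor_insert:
  assumes M: "M \<in> carrier_mat n k" and k: "k > 0" and J: "J \<subseteq> {..<n}" "card J = k - 1"
    and i: "i < n" "i \<notin> J"
  shows "det (submatrix M (insert i J) UNIV) =
    (-1) ^ card {b \<in> J. b < i} * (M *\<^sub>v minor_vec k M J) $ i"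
proof -
  have fin: "finite J" using J finite_subset by blast
  define p where "p = card {b \<in> J. b < i}"
  have "p \<le> card J" unfolding p_def using fin by (intro card_mono) auto
  then have p: "p < k" using k J by simp
  have "{b \<in> insert i J. b < i} = {b \<in> J. b < i}" by auto
  then have pick_p: "pick (insert i J) p = i"
    using pick_card_in_set[of i "insert i J"] by (simp add: p_def)
  have "submatrix M (insert i J) UNIV = mat k k (\<lambda>(a, c). M $$ (pick (insert i J) a, c))"
    using J i k fin by (intro submatrix_rows[OF M]) auto
  also have "det \<dots> = (-1) ^ p * (M *\<^sub>v minor_vec k M J) $ i"
    unfolding mult_minor_vec[OF M i(1)]
    by (subst det_expand_inserted_row[where p = p and q = "pick J"])
       (use p J pick_insert_index[OF fin i(2), folded p_def] in \<open>simp_all add: pick_p\<close>)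
  finally show ?thesis by (simp add: p_def)
qed

text \<open>The coordinate is the determinant of a matrix in which the row \<open>i\<close> occurs twice.\<close>

lemma mult_minor_vec_repeated:
  assumes M: "M \<in> carrier_mat n k" and k: "k > 0" and J: "J \<subseteq> {..<n}" "card J = k - 1"
    and i: "i \<in> J"
  shows "(M *\<^sub>v minor_vec k M J) $ i = 0"
proof -
  have fin: "finite J" and i_less: "i < n" using J i finite_subset by blast+
  define a where "a = card {b \<in> J. b < i}"
  have "{b \<in> J. b < i} \<subset> J" using i by auto
  then have a: "a < k - 1" unfolding a_def using psubset_card_mono[OF fin] J by simp
  have pick_a: "pick J a = i" unfolding a_def by (rule pick_card_in_set[OF i])
  define r where "r = case_nat i (pick J)"
  define R where "R = mat k k (\<lambda>(a, c). M $$ (r a, c))"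
  have "det R = 0"
  proof (rule det_identical_rows)
    show "R \<in> carrier_mat k k" by (simp add: R_def)
    show "row R 0 = row R (Suc a)"
      using a k pick_a by (intro eq_vecI) (simp_all add: R_def r_def)
  qed (use a k in auto)
  moreover have "det R = (-1) ^ 0 * (M *\<^sub>v minor_vec k M J) $ i"
    unfolding R_def mult_minor_vec[OF M i_less]
    by (subst det_expand_inserted_row[where p = 0 and q = "pick J"])
       (use k in \<open>simp_all add: r_def insert_index_def\<close>)
  ultimately show ?thesis by simp
qed

text \<open>The rows shared by all Pluecker coordinates in the numerators of column \<open>j\<close> of \<open>g(N|t)\<close>. Since
  \<open>j\<close> is numbered from 0, this is the interval \<open>[j' - k + 1, j' - 1]\<close> of the formula with \<open>j' = j + 1\<close>.\<close>

definition window :: "nat \<Rightarrow> nat \<Rightarrow> nat \<Rightarrow> nat set" where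
  "window n k j = index_set n {int j + 2 - int k .. int j}"

lemma window_low:
  assumes "j < k" and "k < n"
  shows "window n k j = {..<j} \<union> {n + j + 1 - k ..< n}"
proof (intro equalityI subsetI)
  fix y assume "y \<in> window n k j"
  then obtain i where i: "i \<in> {int j + 2 - int k .. int j}" "y = nat ((i - 1) mod int n)"
    unfolding window_def index_set_def by blast
  define x where "x = i - 1"
  have x: "int j + 1 - int k \<le> x" "x < int j" "y = nat (x mod int n)"
    using i by (auto simp: x_def)
  show "y \<in> {..<j} \<union> {n + j + 1 - k ..< n}"
  proof (cases "x \<ge> 0")
    case True
    then have "x mod int n = x" using x assms by (intro mod_pos_pos_trivial) auto
    then show ?thesis using True x by auto
  next
    case False
    then have "x mod int n = x + int n"
      using x assms mod_pos_pos_trivial[of "x + int n" "int n"] by auto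
    then show ?thesis using False x assms by auto
  qed
next
  fix y assume y: "y \<in> {..<j} \<union> {n + j + 1 - k ..< n}"
  show "y \<in> window n k j"
  proof (cases "y < j")
    case True
    then have "y = nat ((int y + 1 - 1) mod int n)" using assms by simp
    then show ?thesis unfolding window_def index_set_def using True assms
      by (intro image_eqI[of _ _ "int y + 1"]) auto
  next
    case False
    then have y: "n + j + 1 - k \<le> y" "y < n" using y by auto
    have "(int y - int n) mod int n = int y mod int n" by (metis minus_mod_self2)
    then have "y = nat ((int y - int n + 1 - 1) mod int n)" using y by simp
    then show ?thesis unfolding window_def index_set_def using y assms
      by (intro image_eqI[of _ _ "int y - int n + 1"]) auto
  qed
qed

lemma window_high:
  assumes "k \<le> j" and "j < n" and "k > 0"
  shows "window n k j = {j + 1 - k ..< j}"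
proof (intro equalityI subsetI)
  fix y assume "y \<in> window n k j"
  then obtain i where i: "i \<in> {int j + 2 - int k .. int j}" "y = nat ((i - 1) mod int n)"
    unfolding window_def index_set_def by blast
  define x where "x = i - 1"
  have x: "int j + 1 - int k \<le> x" "x < int j" "y = nat (x mod int n)"
    using i by (auto simp: x_def)
  then have "x mod int n = x" using assms by (intro mod_pos_pos_trivial) auto
  then show "y \<in> {j + 1 - k ..< j}" using x assms by auto
next
  fix y assume y: "y \<in> {j + 1 - k ..< j}"
  then have "y = nat ((int y + 1 - 1) mod int n)" using assms by simp
  then show "y \<in> window n k j" unfolding window_def index_set_def using y assms
    by (intro image_eqI[of _ _ "int y + 1"]) auto
qed

lemma window_card:
  assumes "j < n" and "k < n" and "k > 0"
  shows "window n k j \<subseteq> {..<n}" and "card (window n k j) = k - 1"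
proof -
  have "window n k j \<subseteq> {..<n} \<and> card (window n k j) = k - 1"
  proof (cases "j < k")
    case True
    have "card ({..<j} \<union> {n + j + 1 - k ..< n}) = card {..<j} + card {n + j + 1 - k ..< n}"
      using True assms by (intro card_Un_disjoint) auto
    then show ?thesis unfolding window_low[OF True assms(2)] using True assms by auto
  next
    case False
    then show ?thesis using window_high[of k j n] assms by auto
  qed
  then show "window n k j \<subseteq> {..<n}" and "card (window n k j) = k - 1" by blast+
qed

text \<open>The position of \<open>i\<close> in \<open>insert i (window n k j)\<close>. In a column \<open>j < k\<close> it is the same for all \<open>i\<close>;
  in the other columns it is the last place on and below the diagonal, the first place above it. The
  resulting quotient of signs is the sign at which \<open>\<lambda>\<close> gets specialised.\<close>

lemma window_count_less:
  assumes k: "k > 0" "k < n" and ij: "i < n" "j < n" and i: "i \<notin> window n k j"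
  shows "card {b \<in> window n k j. b < i} = (if j < k then j else if j \<le> i then k - 1 else 0)"
proof (cases "j < k")
  case True
  then have "{b \<in> window n k j. b < i} = {..<j}"
    using i ij k unfolding window_low[OF True k(2)] by auto
  then show ?thesis using True by simp
next
  case False
  then have kj: "k \<le> j" by simp
  have "{b \<in> window n k j. b < i} = (if j \<le> i then {j + 1 - k ..< j} else {})"
    using i ij k kj unfolding window_high[OF kj ij(2) k(1)] by auto
  then show ?thesis using False kj k by simp
qed

lemma index_set_insert:
  assumes "i < n"
  shows "index_set n ({int j + 1 - int k + 1 .. int j + 1 - 1} \<union> {int i + 1}) = insert i (window n k j)"
proof -
  have eq: "{int j + 1 - int k + 1 .. int j + 1 - 1} \<union> {int i + 1} =
      insert (int i + 1) {int j + 2 - int k .. int j}" by auto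
  have "nat ((int i + 1 - 1) mod int n) = i" using assms by simp
  then show ?thesis unfolding eq index_set_def window_def image_insert by (rule arg_cong)
qed


lemma coeff_gmat:
  assumes "i < n" and "j < n"
  shows "coeff (gmat n k (N, t) $$ (i, j)) m =
    (if m = (if k \<le> j \<and> i < j then 1 else 0) then
       (if k \<le> j \<and> j \<le> i then t else 1) *
       (plucker n k N ({int j + 1 - int k + 1 .. int j + 1 - 1} \<union> {int i + 1}) /
        plucker n k N {int j + 1 - int k .. int j + 1 - 1})
     else 0)"
  using assms by (auto simp: gmat_def gcoeff_def Let_def coeff_pCons split: nat.split)

text \<open>The rows outside the window are those at which the unfolded matrix stays within distance
  \<open>n - k\<close> below the main diagonal; an entry above the diagonal of \<open>g(N|t)\<close> counts as being \<open>n\<close> rows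
  lower, because of its factor \<open>\<lambda>\<close>.\<close>

lemma not_in_windowD:
  assumes "i < n" and "j < n" and "k > 0" and "k < n" and "i \<notin> window n k j"
  shows "if j < k then j \<le> i \<and> i \<le> j + n - k else j \<le> i \<or> i + k \<le> j"
  using assms by (auto simp: window_low window_high not_less)

lemma plucker_cong:
  "index_set n I = index_set n I' \<Longrightarrow> plucker n k N I = plucker n k N I'"
  by (simp add: plucker_def)

text \<open>The hypothesis says that the coefficient of \<open>\<lambda>\<^sup>m\<close> in the entry \<open>(i, j)\<close> is on the diagonal at
  distance \<open>n - k\<close>. There the inserted row completes the window to the interval in the denominator,
  so that the ratio of Pluecker coordinates is 1.\<close>

lemma index_set_lowest:
  assumes "k > 0" and i: "i < n" and "m * n + i + k = j + n"
  shows "index_set n ({int j + 1 - int k + 1 .. int j + 1 - 1} \<union> {int i + 1}) =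
    index_set n {int j + 1 - int k .. int j + 1 - 1}"
proof -
  have "{int j + 1 - int k .. int j + 1 - 1} =
      insert (int j + 1 - int k) {int j + 1 - int k + 1 .. int j + 1 - 1}"
    using assms(1) by auto
  moreover have "(int j + 1 - int k - 1) mod int n = (int i + 1 - 1) mod int n"
  proof -
    have "int j + 1 - int k - 1 = int i + int n * (int m - 1)"
      using assms(3) by (simp add: algebra_simps flip: of_nat_mult of_nat_add)
    then show ?thesis by simp
  qed
  ultimately show ?thesis by (simp add: index_set_def)
qed

lemma index_set_shift: "index_set n {a + int n .. b + int n} = index_set n {a .. b}"
proof -
  have img: "{a + int n .. b + int n} = (\<lambda>x. x + int n) ` {a .. b}" by simp
  have "(x + int n - 1) mod int n = (x - 1) mod int n" for x
    using mod_add_self2[of "x - 1" "int n"] by (simp add: algebra_simps)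
  then show ?thesis unfolding index_set_def img image_image by simp
qed

text \<open>Makes the choice of a representing matrix behind \<open>plucker\<close> available once and for all, so that
  all coordinates are minors of the same matrix.\<close>

lemma Gr_representative:
  assumes "N \<in> Gr k n"
  obtains M where "M \<in> carrier_mat n k" and "N = vec_space.col_space n M"
    and "\<And>I. plucker n k N I =
      (if card (index_set n I) = k then det (submatrix M (index_set n I) UNIV) else 0)"
proof -
  define M where "M = (SOME M. represents n k M N)"
  have "\<exists>M. represents n k M N" using assms by (simp add: Gr_def)
  then have "represents n k M N" unfolding M_def by (rule someI_ex)
  then show ?thesis using that by (auto simp: represents_def plucker_def Let_def M_def)
qed

lemma plucker_window:
  assumes M: "M \<in> carrier_mat n k"
    and pl: "\<And>I. plucker n k N I =
      (if card (index_set n I) = k then det (submatrix M (index_set n I) UNIV) else 0)"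
    and k: "k > 0" "k < n" and ij: "i < n" "j < n"
  shows "plucker n k N ({int j + 1 - int k + 1 .. int j + 1 - 1} \<union> {int i + 1}) =
    (-1) ^ (if j < k then j else if j \<le> i then k - 1 else 0) *
    (M *\<^sub>v minor_vec k M (window n k j)) $ i"
proof -
  note J = window_card[OF ij(2) k(2,1)]
  have fin: "finite (window n k j)" using J finite_subset by blast
  show ?thesis
  proof (cases "i \<in> window n k j")
    case True
    then have "card (insert i (window n k j)) \<noteq> k" using J k by (simp add: insert_absorb)
    then show ?thesis
      unfolding pl index_set_insert[OF ij(1)] mult_minor_vec_repeated[OF M k(1) J True] by simp
  next
    case False
    then have "card (insert i (window n k j)) = k" using J k fin by simp
    then show ?thesis
      unfolding pl index_set_insert[OF ij(1)]
      using minor_insert[OF M k(1) J ij(1) False] window_count_less[OF k ij False] by simp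
  qed
qed

text \<open>The band structure comes from the vanishing of the coordinates with a repeated row and from the
  entries on the extreme diagonals; the statement about columns comes from \<open>plucker_window\<close>.\<close>

lemma g_map_adapted:
  assumes k: "k > 0" "k < n" and X: "(N, t) \<in> X_var n k" and G: "g_map n k (N, t) = Some G"
  shows "adapted n k ((-1) ^ (k - 1) * t) N G"
proof -
  have t: "t \<noteq> 0" and Gr: "N \<in> Gr k n" using X by (auto simp: X_var_def)
  obtain M where M: "M \<in> carrier_mat n k" "N = vec_space.col_space n M"
    and pl: "\<And>I. plucker n k N I =
      (if card (index_set n I) = k then det (submatrix M (index_set n I) UNIV) else 0)"
    using Gr_representative[OF Gr] by blast
  have G_eq: "G = gmat n k (N, t)"
    and den: "\<And>j. 1 \<le> j \<Longrightarrow> j \<le> int n \<Longrightarrow> plucker n k N {j - int k .. j - 1} \<noteq> 0"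
    using G by (auto simp: g_map_def split: if_splits)
  define d where "d = (\<lambda>j::nat. plucker n k N {int j + 1 - int k .. int j + 1 - 1})"
  define p where "p = (\<lambda>i j::nat. plucker n k N ({int j + 1 - int k + 1 .. int j + 1 - 1} \<union> {int i + 1}))"
  have d: "d j \<noteq> 0" if "j < n" for j using den[of "int j + 1"] that unfolding d_def by auto
  have coeff_G: "coeff (G $$ (i, j)) m =
    (if m = (if k \<le> j \<and> i < j then 1 else 0) then
       (if k \<le> j \<and> j \<le> i then t else 1) * (p i j / d j) else 0)" if "i < n" "j < n" for i j m
    unfolding G_eq p_def d_def by (rule coeff_gmat[OF that])
  have p_window: "p i j = (-1) ^ (if j < k then j else if j \<le> i then k - 1 else 0) *
    (M *\<^sub>v minor_vec k M (window n k j)) $ i" if "i < n" "j < n" for i j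
    unfolding p_def by (rule plucker_window[OF M(1) pl k that])
  have p_0: "p i j = 0" if "i < n" "j < n" "i \<in> window n k j" for i j
    unfolding p_window[OF that(1,2)]
    using mult_minor_vec_repeated[OF M(1) k(1) window_card[OF that(2) k(2,1)] that(3)] by simp
  have cG: "G \<in> carrier_mat n n" by (simp add: G_eq gmat_def)
  have lower: "lower_band n (Suc (n - k)) G"
    unfolding lower_band_def
  proof (intro conjI allI impI cG)
    fix i j m assume ij: "i < n" "j < n" and nz: "coeff (G $$ (i, j)) m \<noteq> 0"
    have m: "m = (if k \<le> j \<and> i < j then 1 else 0)" and "p i j \<noteq> 0"
      using nz unfolding coeff_G[OF ij] by (auto split: if_splits)
    then have "i \<notin> window n k j" using p_0[OF ij] by blast
    from not_in_windowD[OF ij k this] show "j \<le> m * n + i" "m * n + i < j + Suc (n - k)"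
      using ij k unfolding m by (auto split: if_splits)
  qed
  have diag: "coeff (G $$ (j, j)) 0 \<noteq> 0" if j: "j < n" for j
  proof -
    have eq: "{int j + 1 - int k + 1 .. int j + 1 - 1} \<union> {int j + 1}
        = {int j + 2 - int k .. int j + 2 - 1}" using k by auto
    have "p j j \<noteq> 0"
    proof (cases "Suc j < n")
      case True
      then show ?thesis using den[of "int j + 2"] unfolding p_def eq by simp
    next
      \<comment> \<open>In the last column, the interval wraps around to the denominator of the first column.\<close>
      case False
      then have "int j + 2 - int k = 1 - int k + int n" "int j + 2 - 1 = 1 - 1 + int n" using j by auto
      then have "p j j = plucker n k N {1 - int k .. 1 - 1}"
        unfolding p_def eq by (intro plucker_cong) (simp only: index_set_shift)
      then show ?thesis using den[of 1] k by simp
    qed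
    then show ?thesis unfolding coeff_G[OF j j] using t d[OF j] by simp
  qed
  have lead: "coeff (G $$ (i, j)) m = 1"
    if ij: "i < n" "j < n" and eq: "m * n + i = j + (n - k)" for i j m
  proof -
    have eq': "m * n + i + k = j + n" using eq k by simp
    have "p i j = d j" unfolding p_def d_def
      by (rule plucker_cong) (rule index_set_lowest[OF k(1) ij(1) eq'])
    moreover have "m < 2"
    proof (rule ccontr)
      assume "\<not> m < 2"
      then have "2 * n \<le> m * n" by simp
      then show False using eq' ij k by linarith
    qed
    then have "m = 0 \<or> m = 1" by auto
    then have "m = (if k \<le> j \<and> i < j then 1 else 0)" and "\<not> (k \<le> j \<and> j \<le> i)"
      using eq' ij k by auto
    ultimately show ?thesis unfolding coeff_G[OF ij] using d[OF ij(2)] by auto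
  qed
  have monic: "monic_band n (n - k) G"
    unfolding monic_band_def using lower diag lead by blast
  define z where "z = (-1) ^ (k - 1) * t"
  \<comment> \<open>Up to these factors, the columns of \<open>G\<close> at \<open>z\<close> are the images of the vectors \<open>minor_vec\<close>. For
      \<open>k \<le> j\<close>, both \<open>t (-1)\<^sup>k\<^sup>-\<^sup>1\<close> (below the diagonal) and the value of \<open>\<lambda>\<close> (above it) equal \<open>z\<close>.\<close>
  define s where "s = (\<lambda>j. (if j < k then (-1) ^ j else z) / d j)"
  define C where "C = mat k n (\<lambda>(c, j). s j * minor_vec k M (window n k j) $ c)"
  have C: "C \<in> carrier_mat k n" by (simp add: C_def)
  have "eval_mat z G = M * C"
  proof (rule eq_matI)
    fix i j assume "i < dim_row (M * C)" "j < dim_col (M * C)"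
    then have ij: "i < n" "j < n" using M(1) C by auto
    have "degree (G $$ (i, j)) \<le> 1"
      by (rule degree_le) (auto simp: coeff_G[OF ij])
    then have "poly (G $$ (i, j)) z = (\<Sum>m\<le>1. coeff (G $$ (i, j)) m * z ^ m)"
      unfolding poly_altdef by (intro sum.mono_neutral_left) (auto simp: coeff_eq_0)
    also have "\<dots> = (if k \<le> j \<and> i < j then z else if k \<le> j then t else 1) * (p i j / d j)"
      by (auto simp: coeff_G[OF ij])
    also have "\<dots> = s j * (M *\<^sub>v minor_vec k M (window n k j)) $ i"
      unfolding p_window[OF ij] by (auto simp: s_def z_def)
    also have "\<dots> = (M * C) $$ (i, j)"
      using ij M(1)
      by (simp add: C_def scalar_prod_def sum_distrib_left minor_vec_def mult.left_commute)
    finally show "eval_mat z G $$ (i, j) = (M * C) $$ (i, j)"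
      using ij cG by (simp add: eval_mat_def)
  qed (use M(1) C cG in \<open>auto simp: eval_mat_def\<close>)
  then have "cols_in (eval_mat z G) N" using cols_in_mult[OF M(1) C] M(2) by simp
  moreover have "x = 0\<^sub>v n" if xN: "x \<in> N" and 0: "\<forall>i. n - k \<le> i \<and> i < n \<longrightarrow> x $ i = 0" for x
  proof -
    obtain c where c: "c \<in> carrier_vec k" "x = M *\<^sub>v c"
      using xN unfolding M(2) mem_col_space[OF M(1)] by blast
    \<comment> \<open>The rows in the denominator of the first column are the last \<open>k\<close> ones.\<close>
    define I where "I = index_set n {1 - int k .. 1 - 1}"
    have "det (submatrix M I UNIV) \<noteq> 0" and I: "card I = k"
      using den[of 1] k unfolding pl I_def by (auto split: if_splits)
    have I_sub: "I \<subseteq> {n - k ..< n}"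
    proof
      fix i assume "i \<in> I"
      then obtain x where x: "x \<in> {1 - int k .. 1 - 1}" "i = nat ((x - 1) mod int n)"
        unfolding I_def index_set_def by blast
      have "(x - 1) mod int n = x - 1 + int n"
        using x k mod_pos_pos_trivial[of "x - 1 + int n" "int n"] by auto
      then show "i \<in> {n - k ..< n}" using x k by auto
    qed
    have sub: "submatrix M I UNIV = mat k k (\<lambda>(a, c). M $$ (pick I a, c))"
      using I_sub I by (intro submatrix_rows[OF M(1)]) auto
    have "submatrix M I UNIV *\<^sub>v c = 0\<^sub>v k"
    proof (rule eq_vecI)
      fix a assume "a < dim_vec (0\<^sub>v k :: complex vec)"
      then have a: "a < k" by simp
      then have "pick I a \<in> I" using I by (intro pick_in_set_le) simp
      then have pick: "n - k \<le> pick I a" "pick I a < n" using I_sub by auto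
      have "row (submatrix M I UNIV) a = row M (pick I a)"
        unfolding sub using a pick M(1) by (intro eq_vecI) auto
      then have "(submatrix M I UNIV *\<^sub>v c) $ a = x $ pick I a"
        using a pick M(1) c by (simp add: sub)
      then show "(submatrix M I UNIV *\<^sub>v c) $ a = 0\<^sub>v k $ a" using 0 pick a by simp
    qed (simp add: sub)
    then have "c = 0\<^sub>v k"
      using \<open>det (submatrix M I UNIV) \<noteq> 0\<close> c(1)
        det_0_iff_vec_prod_zero[of "submatrix M I UNIV" k] by (auto simp: sub)
    then show ?thesis using c(2) M(1) by auto
  qed
  ultimately show ?thesis
    unfolding adapted_def z_def[symmetric] using monic M by blast
qed

section \<open>Uniqueness of the refactorisation\<close>

definition first_cols :: "nat \<Rightarrow> nat \<Rightarrow> complex mat" where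
  "first_cols n k = mat n k (\<lambda>(i, j). if i = j then 1 else 0)"

lemma first_cols_carrier [simp]: "first_cols n k \<in> carrier_mat n k"
  by (simp add: first_cols_def)

text \<open>The relation between the value \<open>B\<close> of a matrix and the subspace \<open>N\<close> that \<open>pi_map\<close> reads off from
  its first \<open>k\<close> columns. Writing these columns as a product lets the associativity of matrix
  multiplication replace arguments about spans.\<close>

definition spans_image :: "nat \<Rightarrow> nat \<Rightarrow> complex mat \<Rightarrow> complex vec set \<Rightarrow> bool" where
  "spans_image n k B N \<longleftrightarrow> injective_mat k (B * first_cols n k) \<and>
     N = vec_space.col_space n (B * first_cols n k)"

text \<open>A matrix of rank at most \<open>k\<close> with \<open>k\<close> independent columns has all its columns in their span.\<close>

lemma spans_image_cols_in:
  assumes N: "spans_image n k (P * C) N" and P: "P \<in> carrier_mat n k" and C: "C \<in> carrier_mat k n"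
  shows "cols_in P N" and "cols_in (P * C) N"
proof -
  have W: "P * C * first_cols n k = P * (C * first_cols n k)"
    by (rule assoc_mult_mat[OF P C first_cols_carrier])
  have Y: "C * first_cols n k \<in> carrier_mat k k" using C by simp
  obtain Z where Z: "Z \<in> carrier_mat k k" "P = P * C * first_cols n k * Z"
    using injective_mat_factor[OF _ W P Y] N unfolding spans_image_def by metis
  have cW: "P * C * first_cols n k \<in> carrier_mat n k"
    unfolding W using P Y by (rule mult_carrier_mat)
  have N': "N = vec_space.col_space n (P * C * first_cols n k)"
    using N by (simp add: spans_image_def)
  show "cols_in P N"
    unfolding N' by (subst Z(2)) (rule cols_in_mult[OF cW Z(1)])
  then show "cols_in (P * C) N"
    unfolding N' by (intro cols_in_mult_right[OF cW P C])
qed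

lemma spans_image_le:
  assumes N: "spans_image n k (P * C) N" and P: "P \<in> carrier_mat n l" and C: "C \<in> carrier_mat l n"
  shows "k \<le> l"
proof (rule injective_mat_factor_le[OF _ _ P])
  show "injective_mat k (P * C * first_cols n k)" using N by (simp add: spans_image_def)
  show "P * C * first_cols n k = P * (C * first_cols n k)"
    by (rule assoc_mult_mat[OF P C first_cols_carrier])
  show "C * first_cols n k \<in> carrier_mat l k" using C by simp
qed

text \<open>The identity \<open>g \<circ> S = fl \<circ> g\<close>: the reflected matrix is a monic band matrix again, and at \<open>z\<close> it still
  has rank at most \<open>k\<close>, so its columns lie in the span \<open>N'\<close> of the first \<open>k\<close> of them.\<close>

lemma adapted_flip_mat:
  assumes n: "n > 0" and k: "k \<le> n" and G: "adapted n k z N G"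
    and N': "spans_image n k (eval_mat z (flip_mat n G)) N'" and G': "adapted n k z N' G'"
  shows "G' = flip_mat n G"
proof -
  obtain M C where M: "M \<in> carrier_mat n k" "C \<in> carrier_mat k n" "eval_mat z G = M * C"
    using adapted_factor[OF G] by metis
  have eq: "eval_mat z (flip_mat n G) =
      mat n k (\<lambda>(i, j). C $$ (j, n - 1 - i)) * mat k n (\<lambda>(i, j). M $$ (n - 1 - j, i))"
    unfolding eval_mat_flip_mat[OF adapted_carrier[OF G]] M(3) by (rule flip_mat_factor[OF M(1,2)])
  have "cols_in (eval_mat z (flip_mat n G)) N'"
    unfolding eq by (rule spans_image_cols_in(2)[OF N'[unfolded eq] mat_carrier mat_carrier])
  moreover have "monic_band n (n - k) (flip_mat n G)"
    using G by (simp add: adapted_def monic_band_flip_mat)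
  ultimately show ?thesis using adapted_unique[OF n k G'] by metis
qed

text \<open>The core of the theorem, with \<open>U = g(u)\<close>, \<open>V = g(v)\<close>, \<open>B = g(v')\<close> and \<open>flip_mat n A = g(u')\<close>; the
  matrix \<open>A\<close> is the value of \<open>g\<close> at \<open>\<Psi>\<^bsub>l,k\<^esub>(S(v), S(u))\<close>. Since \<open>A\<close> divides on the left after reflection, its
  reflection divides on the right.\<close>

lemma refactorization_unique:
  assumes n: "n > 0" and k: "k \<le> n" and l: "l \<le> n"
    and U: "adapted n l zs M U" and V: "adapted n k zt N V"
    and N': "spans_image n k (eval_mat zt (U * V)) N'" and B: "adapted n k zt N' B"
    and Us: "adapted n l zs Ms (flip_mat n U)" and Vs: "adapted n k zt Ns (flip_mat n V)"
    and Q: "spans_image n l (eval_mat zs (flip_mat n V * flip_mat n U)) Q" and A: "adapted n l zs Q A"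
    and flip_A: "adapted n l zs M' (flip_mat n A)"
  shows "U * V = B * flip_mat n A"
proof -
  note carrier = adapted_carrier[OF U] adapted_carrier[OF V] adapted_carrier[OF B]
    adapted_carrier[OF A] flip_mat_carrier
  have monic: "monic_band n (n - l) U" "monic_band n (n - k) V" "monic_band n (n - k) B"
    "monic_band n (n - l) A" "monic_band n (n - l) (flip_mat n A)"
    using U V B A flip_A by (simp_all add: adapted_def)
  show ?thesis
  proof (cases "zs = zt")
    case False
    obtain MB where MB: "MB \<in> carrier_mat n k" "N' = vec_space.col_space n MB"
      using adapted_factor[OF B] by metis
    obtain MQ where MQ: "MQ \<in> carrier_mat n l" "Q = vec_space.col_space n MQ"
      using adapted_factor[OF A] by metis
    define D where "D = U * V - B * flip_mat n A"
    have UV: "U * V \<in> carrier_mat n n" and BA: "B * flip_mat n A \<in> carrier_mat n n"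
      using carrier by (auto intro: mult_carrier_mat)
    have D: "D \<in> carrier_mat n n" unfolding D_def using BA by (rule minus_carrier_mat)
    \<comment> \<open>The last diagonals cancel, so one diagonal is lost.\<close>
    have D_band: "lower_band n (n - l + (n - k)) D"
      unfolding D_def
    proof (rule monic_band_diff)
      show "monic_band n (n - l + (n - k)) (U * V)" by (rule monic_band_mult[OF n monic(1,2)])
      show "monic_band n (n - l + (n - k)) (B * flip_mat n A)"
        using monic_band_mult[OF n monic(3,5)] by (simp add: add.commute)
    qed
    \<comment> \<open>Both products have their columns at \<open>zt\<close> in \<open>N'\<close>: the first one because its rank is at most \<open>k\<close>
      there, the second one because \<open>B\<close> has its columns in \<open>N'\<close>.\<close>
    have "cols_in (eval_mat zt D) N'"
    proof -
      obtain P C where P: "P \<in> carrier_mat n k" "C \<in> carrier_mat k n" "eval_mat zt V = P * C"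
        using adapted_factor[OF V] by metis
      have eU: "eval_mat zt U \<in> carrier_mat n n" using carrier by simp
      have eq: "eval_mat zt (U * V) = eval_mat zt U * P * C"
        unfolding eval_mat_mult[OF carrier(1,2)] P(3) using eU P by simp
      have 1: "cols_in (eval_mat zt (U * V)) N'"
        unfolding eq by (rule spans_image_cols_in(2)) (use N'[unfolded eq] eU P in simp_all)
      have 2: "cols_in (eval_mat zt (B * flip_mat n A)) N'"
        unfolding eval_mat_mult[OF carrier(3) flip_mat_carrier] MB(2)
        by (rule cols_in_mult_right[OF MB(1), where p = n and q = n]) (use carrier B MB(2) in \<open>simp_all add: adapted_def\<close>)
      show ?thesis
        unfolding D_def eval_mat_minus[OF UV BA] MB(2)
        by (rule cols_in_minus[OF MB(1)]) (use 1 2 MB(2) UV BA in simp_all)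
    qed
    then obtain F where F: "F \<in> carrier_mat n n" "D = B * F"
      using adapted_division[OF n k B D] by blast
    have F_band: "lower_band n (n - l) F"
      by (rule lower_band_cancel_left[OF n monic(3) F(1)]) (use D_band F(2) in simp)
    have flip_D: "flip_mat n D = flip_mat n F * flip_mat n B"
      unfolding F(2) by (rule flip_mat_mult[OF carrier(3) F(1)])
    \<comment> \<open>The same argument for the reflected products at the other value.\<close>
    have "cols_in (eval_mat zs (flip_mat n D)) Q"
    proof -
      have eq: "flip_mat n D = flip_mat n V * flip_mat n U - A * flip_mat n B"
      proof -
        have "flip_mat n D = flip_mat n (U * V) - flip_mat n (B * flip_mat n A)"
          unfolding D_def by (rule flip_mat_minus[OF UV BA])
        then show ?thesis
          using carrier by (simp add: flip_mat_mult flip_mat_flip_mat)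
      qed
      obtain P C where P: "P \<in> carrier_mat n l" "C \<in> carrier_mat l n"
        "eval_mat zs (flip_mat n U) = P * C"
        using adapted_factor[OF Us] by metis
      have VU: "flip_mat n V * flip_mat n U \<in> carrier_mat n n"
        and AB: "A * flip_mat n B \<in> carrier_mat n n"
        using carrier by (auto intro: mult_carrier_mat[of _ n n])
      have eV: "eval_mat zs (flip_mat n V) \<in> carrier_mat n n" by simp
      have eq': "eval_mat zs (flip_mat n V * flip_mat n U) = eval_mat zs (flip_mat n V) * P * C"
        unfolding eval_mat_mult[OF flip_mat_carrier flip_mat_carrier] P(3)
        using eV P by (simp add: assoc_mult_mat[of _ n n _ l _ n])
      have 1: "cols_in (eval_mat zs (flip_mat n V * flip_mat n U)) Q"
        unfolding eq'
        by (rule spans_image_cols_in(2)[OF Q[unfolded eq'] mult_carrier_mat[OF eV P(1)] P(2)])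
      have 2: "cols_in (eval_mat zs (A * flip_mat n B)) Q"
        unfolding eval_mat_mult[OF carrier(4) flip_mat_carrier] MQ(2)
        by (rule cols_in_mult_right[OF MQ(1), where p = n and q = n]) (use carrier A MQ(2) in \<open>simp_all add: adapted_def\<close>)
      show ?thesis
        unfolding eq eval_mat_minus[OF VU AB] MQ(2)
        by (rule cols_in_minus[OF MQ(1)]) (use 1 2 MQ(2) VU AB in simp_all)
    qed
    then have Dz: "cols_in (eval_mat zs (flip_mat n F) * flip_mat n (eval_mat zs B)) Q"
      unfolding flip_D eval_mat_mult[OF flip_mat_carrier flip_mat_carrier]
      by (simp add: eval_mat_flip_mat[OF carrier(3)])
    \<comment> \<open>The factor \<open>flip_mat n B\<close> can be removed because \<open>B\<close> is invertible at \<open>zs \<noteq> zt\<close>.\<close>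
    have "cols_in (eval_mat zs (flip_mat n F)) Q"
    proof -
      obtain R where R: "R \<in> carrier_mat n n" "R * eval_mat zs B = 1\<^sub>m n"
        using adapted_eval_invertible[OF n k B False] by blast
      have "flip_mat n (eval_mat zs B) * flip_mat n R = flip_mat n (1\<^sub>m n)"
        using flip_mat_mult[OF R(1), of "eval_mat zs B"] carrier R(2) by simp
      also have "\<dots> = 1\<^sub>m n" by (rule eq_matI) (auto simp: flip_mat_def)
      finally have "eval_mat zs (flip_mat n F) =
          eval_mat zs (flip_mat n F) * (flip_mat n (eval_mat zs B) * flip_mat n R)"
        by (simp add: right_mult_one_mat[of _ n n])
      also have "\<dots> = eval_mat zs (flip_mat n F) * flip_mat n (eval_mat zs B) * flip_mat n R"
        by (rule assoc_mult_mat[symmetric, of _ n n _ n _ n]) simp_all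
      finally have eq: "eval_mat zs (flip_mat n F) =
        eval_mat zs (flip_mat n F) * flip_mat n (eval_mat zs B) * flip_mat n R" .
      have "eval_mat zs (flip_mat n F) * flip_mat n (eval_mat zs B) \<in> carrier_mat n n"
        by (rule mult_carrier_mat[of _ n n]) simp_all
      from cols_in_mult_right[OF MQ(1) this flip_mat_carrier Dz[unfolded MQ(2)]]
      show ?thesis unfolding MQ(2) using eq by metis
    qed
    then obtain E where E: "E \<in> carrier_mat n n" "flip_mat n F = A * E"
      using adapted_division[OF n l A flip_mat_carrier] by blast
    have "lower_band n (0 + (n - l)) (A * E)"
      using lower_band_flip_mat[OF F_band] E(2) by simp
    then have "E = 0\<^sub>m n n" using lower_band_0 lower_band_cancel_left[OF n monic(4) E(1)] by blast
    then have "flip_mat n F = 0\<^sub>m n n" using E carrier(4) by simp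
    then have "F = flip_mat n (0\<^sub>m n n)" using flip_mat_flip_mat[OF F(1)] by metis
    also have "\<dots> = 0\<^sub>m n n" by (rule eq_matI) (auto simp: flip_mat_def)
    finally have "D = 0\<^sub>m n n" using F(2) carrier(3) by simp
    then show ?thesis unfolding D_def by (rule minus_mat_eq_0D[OF UV BA])
  next
    case True
    obtain P C where P: "P \<in> carrier_mat n l" "C \<in> carrier_mat l n" "eval_mat zt U = P * C"
      using adapted_factor[OF U] True by metis
    obtain P' C' where P': "P' \<in> carrier_mat n k" "C' \<in> carrier_mat k n"
      "eval_mat zs (flip_mat n V) = P' * C'"
      using adapted_factor[OF Vs] True by metis
    have eV: "eval_mat zt V \<in> carrier_mat n n" using carrier by simp
    have eU: "eval_mat zs (flip_mat n U) \<in> carrier_mat n n" by simp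
    have eq: "eval_mat zt (U * V) = P * (C * eval_mat zt V)"
      unfolding eval_mat_mult[OF carrier(1,2)] P(3) using eV P by simp
    have eq': "eval_mat zs (flip_mat n V * flip_mat n U) = P' * (C' * eval_mat zs (flip_mat n U))"
      unfolding eval_mat_mult[OF flip_mat_carrier flip_mat_carrier] P'(3)
      by (rule assoc_mult_mat[OF P'(1,2) eU])
    have cC: "C * eval_mat zt V \<in> carrier_mat l n" and cC': "C' * eval_mat zs (flip_mat n U) \<in> carrier_mat k n"
      using mult_carrier_mat[OF P(2) eV] mult_carrier_mat[OF P'(2) eU] .
    \<comment> \<open>The rank of \<open>U * V\<close> at the common value is at most \<open>l\<close>, and that of its reflection at most \<open>k\<close>.\<close>
    have kl: "k = l"
      using spans_image_le[OF N'[unfolded eq] P(1) cC] spans_image_le[OF Q[unfolded eq'] P'(1) cC'] by simp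
    obtain MB where MB: "MB \<in> carrier_mat n k" "N' = vec_space.col_space n MB"
      using adapted_factor[OF B] by metis
    obtain MQ where MQ: "MQ \<in> carrier_mat n l" "Q = vec_space.col_space n MQ"
      using adapted_factor[OF A] by metis
    have "cols_in P N'"
      using spans_image_cols_in(1)[OF N'[unfolded eq]] P cC kl by simp
    then have "cols_in (eval_mat zt U) N'"
      unfolding P(3) MB(2) by (rule cols_in_mult_right[OF MB(1) P(1,2)])
    then have U_B: "U = B" using adapted_unique[OF n k B] monic(1) kl by simp
    have "cols_in P' Q"
      using spans_image_cols_in(1)[OF Q[unfolded eq']] P' cC' kl by simp
    then have "cols_in (eval_mat zs (flip_mat n V)) Q"
      unfolding P'(3) MQ(2) by (rule cols_in_mult_right[OF MQ(1) P'(1,2)])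
    then have "flip_mat n V = A"
      using adapted_unique[OF n l A] monic_band_flip_mat[OF monic(2)] kl by simp
    then have "flip_mat n A = V" using flip_mat_flip_mat[OF carrier(2)] by simp
    then show ?thesis using U_B by simp
  qed
qed

section \<open>The geometric R-matrix\<close>

text \<open>Translates \<open>pi_map\<close> into matrix products: independence of the columns becomes injectivity, and
  full rank makes the result a point of the Grassmannian.\<close>

lemma pi_map_spans_image:
  assumes A: "A \<in> carrier_mat n n" and k: "k \<le> n" and pi: "pi_map n k t A = Some x"
  obtains N where "x = (N, t)" and "N \<in> Gr k n"
    and "spans_image n k (eval_mat ((-1) ^ (k - 1) * t) A) N"
proof -
  define B where "B = eval_mat ((-1) ^ (k - 1) * t) A"
  define W where "W = B * first_cols n k"
  have B: "B \<in> carrier_mat n n" using A by (simp add: B_def)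
  have W: "W \<in> carrier_mat n k" unfolding W_def using B first_cols_carrier by (rule mult_carrier_mat)
  have "mat_of_cols n (take k (cols B)) = W"
  proof (rule eq_matI)
    fix i j assume "i < dim_row W" "j < dim_col W"
    then have ij: "i < n" "j < k" using W by auto
    have "W $$ (i, j) = (\<Sum>p<n. B $$ (i, p) * (if p = j then 1 else 0))"
      using ij B k by (simp add: W_def first_cols_def scalar_prod_def atLeast0LessThan)
    also have "\<dots> = B $$ (i, j)" using ij k by (simp add: sum.delta if_distrib cong: if_cong)
    also have "\<dots> = mat_of_cols n (take k (cols B)) $$ (i, j)"
      using ij B k by (simp add: mat_of_cols_def)
    finally show "mat_of_cols n (take k (cols B)) $$ (i, j) = W $$ (i, j)" ..
  qed (use W B k in auto)
  then have indep: "indep_cols n W" and x: "x = (vec_space.col_space n W, t)"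
    using pi unfolding pi_map_def B_def[unfolded eval_mat_def, symmetric] Let_def
    by (auto split: if_splits)
  have "vec_space.rank n W = k"
    using vec_space.lin_indpt_full_rank[OF W] indep by (simp add: indep_cols_def)
  then have "vec_space.col_space n W \<in> Gr k n" using W by (auto simp: Gr_def represents_def)
  moreover have "injective_mat k W"
    using vec_space.lin_depI[OF W] indep W by (auto simp: injective_mat_def indep_cols_def)
  ultimately show ?thesis using that[OF x] by (simp add: spans_image_def W_def B_def)
qed

lemma S_map_adapted:
  assumes k: "k > 0" "k < n" and x: "x \<in> X_var n k" and S: "S_map n k x = Some y"
    and g: "g_map n k x = Some G"
  shows "y \<in> X_var n k" and "snd y = snd x"
    and "g_map n k y = Some G' \<Longrightarrow> G' = flip_mat n G"
proof -
  obtain N t where Nt: "x = (N, t)" by (cases x)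
  have t: "t \<noteq> 0" using x by (simp add: X_var_def Nt)
  have pi: "pi_map n k t (flip_mat n G) = Some y" using S g by (simp add: S_map_def Nt)
  obtain N' where N': "y = (N', t)" "N' \<in> Gr k n"
    "spans_image n k (eval_mat ((-1) ^ (k - 1) * t) (flip_mat n G)) N'"
    using pi_map_spans_image[OF flip_mat_carrier _ pi] k by auto
  show y: "y \<in> X_var n k" and "snd y = snd x" using N' t by (simp_all add: X_var_def Nt)
  assume g': "g_map n k y = Some G'"
  have G: "adapted n k ((-1) ^ (k - 1) * t) N G" using g_map_adapted[OF k] x g by (simp add: Nt)
  have G': "adapted n k ((-1) ^ (k - 1) * t) N' G'" using g_map_adapted[OF k] y g' by (simp add: N'(1))
  show "G' = flip_mat n G" by (rule adapted_flip_mat[OF _ _ G N'(3) G']) (use k in auto)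
qed

theorem theorem5p4:
  fixes n l k :: nat and u v u' v' :: point and A' B' :: "complex poly mat"
  assumes "n \<ge> 2"
    and "l \<in> {1..n - 1}" and "k \<in> {1..n - 1}"
    and "u \<in> X_var n l" and "v \<in> X_var n k"
    and "geom_R n l k (u, v) = Some (v', u')"
    and "g_map n k v' = Some B'" and "g_map n l u' = Some A'"
  shows "\<exists>A B. g_map n l u = Some A \<and> g_map n k v = Some B \<and> A * B = B' * A'"
proof -
  have k: "k > 0" "k < n" and l: "l > 0" "l < n" using assms(1-3) by auto
  obtain M s where u: "u = (M, s)" by (cases u)
  obtain N t where v: "v = (N, t)" by (cases v)
  from assms(6) obtain v1 u1 w where Psi: "Psi n k l (u, v) = Some v'"
    and Sv: "S_map n k v = Some v1" and Su: "S_map n l u = Some u1"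
    and Psi': "Psi n l k (v1, u1) = Some w" and Sw: "S_map n l w = Some u'"
    by (auto simp: geom_R_def S_pair_def bind_eq_Some_conv)
  obtain M1 s1 where u1: "u1 = (M1, s1)" by (cases u1)
  obtain N1 t1 where v1: "v1 = (N1, t1)" by (cases v1)
  obtain U V where g: "g_map n l u = Some U" "g_map n k v = Some V"
    and pi: "pi_map n k t (U * V) = Some v'"
    using Psi by (auto simp: Psi_def v bind_eq_Some_conv)
  obtain V1 U1 where g1: "g_map n k v1 = Some V1" "g_map n l u1 = Some U1"
    and pi1: "pi_map n l s1 (V1 * U1) = Some w"
    using Psi' by (auto simp: Psi_def u1 bind_eq_Some_conv)
  note u1_props = S_map_adapted[OF l assms(4) Su g(1)] and v1_props = S_map_adapted[OF k assms(5) Sv g(2)]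
  have s1: "s1 = s" and t1: "t1 = t" using u1_props(2) v1_props(2) by (simp_all add: u v u1 v1)
  have U1: "U1 = flip_mat n U" and V1: "V1 = flip_mat n V"
    using u1_props(3) v1_props(3) g1 by blast+
  have nz: "s \<noteq> 0" "t \<noteq> 0" using assms(4,5) by (simp_all add: X_var_def u v)
  define zs zt where "zs = (-1) ^ (l - 1) * s" and "zt = (-1) ^ (k - 1) * t"
  have U: "adapted n l zs M U" and V: "adapted n k zt N V"
    using g_map_adapted[OF l] g_map_adapted[OF k] assms(4,5) g by (simp_all add: u v zs_def zt_def)
  have Us: "adapted n l zs M1 (flip_mat n U)" and Vs: "adapted n k zt N1 (flip_mat n V)"
    using g_map_adapted[OF l, of M1 s] g_map_adapted[OF k, of N1 t] u1_props(1) v1_props(1) g1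
    by (simp_all add: u1 v1 s1 t1 zs_def zt_def U1 V1)
  note carrier = adapted_carrier[OF U] adapted_carrier[OF V]
  obtain N' where N': "v' = (N', t)" "N' \<in> Gr k n" "spans_image n k (eval_mat zt (U * V)) N'"
    using pi_map_spans_image[OF _ _ pi] carrier k unfolding zt_def by auto
  have "flip_mat n V * flip_mat n U \<in> carrier_mat n n"
    by (rule mult_carrier_mat[OF flip_mat_carrier flip_mat_carrier])
  then obtain Q where Q: "w = (Q, s)" "Q \<in> Gr l n"
    "spans_image n l (eval_mat zs (flip_mat n V * flip_mat n U)) Q"
    using pi_map_spans_image[OF _ _ pi1[unfolded U1 V1 s1]] l unfolding zs_def by auto
  have w: "w \<in> X_var n l" using Q nz by (simp add: X_var_def)
  obtain A where gw: "g_map n l w = Some A"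
    using Sw by (auto simp: S_map_def bind_eq_Some_conv Q(1))
  have A: "adapted n l zs Q A" using g_map_adapted[OF l] w gw by (simp add: Q(1) zs_def)
  have B: "adapted n k zt N' B'"
    using g_map_adapted[OF k, of N' t] N' nz assms(7) by (simp add: X_var_def zt_def)
  note u'_props = S_map_adapted[OF l w Sw gw]
  have A': "A' = flip_mat n A" by (rule u'_props(3)[OF assms(8)])
  obtain M' where u': "u' = (M', s)" using u'_props(2) by (cases u') (simp add: Q(1))
  have flip_A: "adapted n l zs M' (flip_mat n A)"
    using g_map_adapted[OF l, of M' s] u'_props(1) assms(8) by (simp add: u' A' zs_def)
  have "U * V = B' * flip_mat n A"
    by (rule refactorization_unique[OF _ _ _ U V N'(3) B Us Vs Q(3) A flip_A]) (use k l in auto)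
  then show ?thesis using g A' by blast
qed

end
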